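(* Let $A\in\mathbb{R}^{m\times n}$ and $b\in\mathbb{R}^m$ be such that the system $Ax=b$ is consistent, let $B\in\mathbb{R}^{n\times n}$ be symmetric positive definite, and let $S$ be a random real matrix with $m$ rows and $q$ columns (where $q$ itself may be random). Let $Z=A^TS(S^TAB^{-1}A^TS)^{\dagger}S^TA$ and $\rho=1-\lambda_{\min}(B^{-1/2}\mathbf{E}[Z]B^{-1/2})$. If $\mathbf{E}[Z]$ is invertible, then $\rho<1$, $A$ has full column rank, and the solution $x^*$ of $Ax=b$ is unique.
   Context: $M^\dagger$ denotes the Moore-Penrose pseudoinverse, $\lambda_{\min}$ the smallest eigenvalue, and $\mathbf{E}[\cdot]$ expectation over the random matrix $S$. *)

theory Defs
  imports
    "HOL-Probability.Probability"
    "Jordan_Normal_Form.Spectral_Radius"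
    "Jordan_Normal_Form.Gauss_Jordan_Elimination"
    "Jordan_Normal_Form.DL_Rank"
begin

definition spd_mat :: "nat \<Rightarrow> real mat \<Rightarrow> bool" where
  "spd_mat n B \<longleftrightarrow>
     B \<in> carrier_mat n n \<and> transpose_mat B = B \<and>
     (\<forall>x \<in> carrier_vec n. x \<noteq> 0\<^sub>v n \<longrightarrow> scalar_prod x (B *\<^sub>v x) > 0)"

(* mat_inverse returns None on singular matrices; inv_mat is meaningful for invertible ones only. *)
definition inv_mat :: "real mat \<Rightarrow> real mat" where
  "inv_mat B = the (mat_inverse B)"

(* The unique symmetric positive definite square root; meaningful when spd_mat (dim_row B) B. *)
definition sqrt_mat :: "real mat \<Rightarrow> real mat" where
  "sqrt_mat B = (THE R. spd_mat (dim_row B) R \<and> R * R = B)"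

definition inv_sqrt_mat :: "real mat \<Rightarrow> real mat" where
  "inv_sqrt_mat B = inv_mat (sqrt_mat B)"

(* The four Penrose conditions, over the reals. *)
definition is_mp_inverse :: "real mat \<Rightarrow> real mat \<Rightarrow> bool" where
  "is_mp_inverse M X \<longleftrightarrow>
     X \<in> carrier_mat (dim_col M) (dim_row M) \<and>
     M * X * M = M \<and> X * M * X = X \<and>
     transpose_mat (M * X) = M * X \<and> transpose_mat (X * M) = X * M"

definition mp_inverse :: "real mat \<Rightarrow> real mat" where
  "mp_inverse M = (THE X. is_mp_inverse M X)"

definition lambda_min :: "real mat \<Rightarrow> real" where
  "lambda_min M = Min (spectrum M)"

(* A random matrix with m rows and a possibly random number of columns, i.e. a measurable map into
   the disjoint union over q of the spaces of m x q matrices: the number of columns is measurable,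
   and each entry is measurable on the event where it exists. *)
definition random_mat :: "'w measure \<Rightarrow> nat \<Rightarrow> ('w \<Rightarrow> real mat) \<Rightarrow> bool" where
  "random_mat P m S \<longleftrightarrow>
     (\<forall>\<omega> \<in> space P. dim_row (S \<omega>) = m) \<and>
     (\<lambda>\<omega>. dim_col (S \<omega>)) \<in> measurable P (count_space UNIV) \<and>
     (\<forall>i < m. \<forall>j. (\<lambda>\<omega>. S \<omega> $$ (i, j))
        \<in> borel_measurable (restrict_space P {\<omega> \<in> space P. j < dim_col (S \<omega>)}))"

definition expectation_mat ::
    "'w measure \<Rightarrow> nat \<Rightarrow> nat \<Rightarrow> ('w \<Rightarrow> real mat) \<Rightarrow> real mat" where
  "expectation_mat P r c F = mat r c (\<lambda>(i, j). integral\<^sup>L P (\<lambda>\<omega>. F \<omega> $$ (i, j)))"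

definition sketch_Z :: "real mat \<Rightarrow> real mat \<Rightarrow> real mat \<Rightarrow> real mat" where
  "sketch_Z A B S =
     transpose_mat A * S
       * mp_inverse (transpose_mat S * A * inv_mat B * transpose_mat A * S)
       * transpose_mat S * A"

definition expected_Z ::
    "'w measure \<Rightarrow> real mat \<Rightarrow> real mat \<Rightarrow> ('w \<Rightarrow> real mat) \<Rightarrow> real mat" where
  "expected_Z P A B S = expectation_mat P (dim_col A) (dim_col A) (\<lambda>\<omega>. sketch_Z A B (S \<omega>))"

definition rho ::
    "'w measure \<Rightarrow> real mat \<Rightarrow> real mat \<Rightarrow> ('w \<Rightarrow> real mat) \<Rightarrow> real" where
  "rho P A B S = 1 - lambda_min (inv_sqrt_mat B * expected_Z P A B S * inv_sqrt_mat B)"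

end

theory Submission
  imports Defs
begin

text \<open>
  With \<open>R = B\<^sup>1\<^sup>/\<^sup>2\<close>, \<open>L = R\<^sup>-\<^sup>1\<close> and \<open>C = L A\<^sup>T S\<close>, the matrix \<open>Z\<close> equals \<open>R Q R\<close>, where
  \<open>Q = C (C\<^sup>T C)\<^sup>\<dagger> C\<^sup>T\<close> is the orthogonal projection onto the range of \<open>C\<close>. So \<open>Z\<close> is symmetric,
  positive semidefinite and bounded uniformly in \<open>S\<close>. It is also measurable, although the
  pseudoinverse is discontinuous and the number of columns of \<open>S\<close> varies: \<open>Q\<close> depends only on the
  square matrix \<open>W = C C\<^sup>T\<close> of fixed size and is the limit of \<open>W (W + \<delta> I)\<^sup>-\<^sup>1\<close> as \<open>\<delta>\<close> tends to \<open>0\<close>.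
  Hence \<open>Z\<close> is integrable, and its expectation is positive semidefinite and vanishes on the kernel of \<open>A\<close>.
  If the expectation is invertible, then \<open>A\<close> is injective and all eigenvalues of \<open>L E[Z] L\<close> are
  positive.
\<close>

unbundle no inner_syntax
unbundle no vec_syntax

section \<open>Matrix laws in terms of dimensions, and real scalar products\<close>

text \<open>With equations between dimensions as side conditions, this law and the next two serve as
  rewrite rules that leave no carrier size to be guessed.\<close>

lemma mult_assoc_dim:
  fixes A B C :: "'a :: semiring_0 mat"
  assumes "dim_col A = dim_row B" "dim_col B = dim_row C"
  shows "A * B * C = A * (B * C)"
  using assms by (intro assoc_mult_mat[of _ "dim_row A" "dim_row B" _ "dim_row C" _ "dim_col C"]) auto

lemma mult_vec_assoc_dim:
  fixes A B :: "'a :: semiring_0 mat"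
  assumes "dim_col A = dim_row B" "dim_col B = dim_vec v"
  shows "A * B *\<^sub>v v = A *\<^sub>v (B *\<^sub>v v)"
  using assms by (intro assoc_mult_mat_vec[of _ "dim_row A" "dim_row B" _ "dim_col B"]) auto

lemma transpose_mult_dim:
  fixes A B :: "'a :: comm_semiring_0 mat"
  assumes "dim_col A = dim_row B"
  shows "(A * B)\<^sup>T = B\<^sup>T * A\<^sup>T"
  using assms by (intro transpose_mult[of _ "dim_row A" "dim_row B" _ "dim_col B"]) auto

lemma scalar_prod_real_nonneg: "scalar_prod v v \<ge> (0 :: real)"
  by (auto simp: scalar_prod_def intro: sum_nonneg)

lemma scalar_prod_real_pos:
  fixes v :: "real vec"
  assumes "v \<in> carrier_vec n" "v \<noteq> 0\<^sub>v n"
  shows "scalar_prod v v > 0"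
proof -
  obtain i where "i < n" "v $ i \<noteq> 0"
    using assms by (metis carrier_vecD eq_vecI index_zero_vec)
  then show ?thesis
    using assms by (auto simp: scalar_prod_def zero_less_mult_iff intro!: sum_pos2[of _ i])
qed

section \<open>Spectral theorem for real symmetric matrices\<close>

lemma symmetric_scalar_prod:
  fixes M :: "real mat"
  assumes "M \<in> carrier_mat n n" "M\<^sup>T = M" "x \<in> carrier_vec n" "y \<in> carrier_vec n"
  shows "scalar_prod (M *\<^sub>v x) y = scalar_prod x (M *\<^sub>v y)"
  using transpose_vec_mult_scalar[of M n n y x] assms by simp

text \<open>A complex eigenvector \<open>w\<close> exists over the algebraically closed field. Split
  it into real and imaginary parts \<open>x\<close> and \<open>y\<close>. Symmetry of
  \<open>M\<close>, applied to the pair \<open>x\<close>, \<open>y\<close>, forces the imaginary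
  part of the eigenvalue times \<open>|x|^2 + |y|^2\<close> to be zero, so the eigenvalue is real
  and whichever part is nonzero is a real eigenvector.\<close>

lemma symmetric_real_eigenvector:
  fixes M :: "real mat"
  assumes M: "M \<in> carrier_mat n n" and sym: "M\<^sup>T = M" and n: "n > 0"
  obtains v k where "v \<in> carrier_vec n" "v \<noteq> 0\<^sub>v n" "M *\<^sub>v v = k \<cdot>\<^sub>v v"
proof -
  let ?Mc = "map_mat complex_of_real M"
  have Mc: "?Mc \<in> carrier_mat n n" using M by simp
  from spectrum_non_empty[OF Mc n] obtain \<mu> w where "eigenvector ?Mc w \<mu>"
    unfolding spectrum_def eigenvalue_def by auto
  then have w: "w \<in> carrier_vec n" "w \<noteq> 0\<^sub>v n" "?Mc *\<^sub>v w = \<mu> \<cdot>\<^sub>v w"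
    using M unfolding eigenvector_def by auto
  define x where "x = map_vec Re w"
  define y where "y = map_vec Im w"
  have xy: "x \<in> carrier_vec n" "y \<in> carrier_vec n" using w by (auto simp: x_def y_def)
  have comp: "(\<Sum>j<n. complex_of_real (M $$ (i, j)) * w $ j) = \<mu> * w $ i" if "i < n" for i
  proof -
    have "(?Mc *\<^sub>v w) $ i = (\<mu> \<cdot>\<^sub>v w) $ i" using w(3) by simp
    then show ?thesis using M w(1) that by (simp add: scalar_prod_def lessThan_atLeast0)
  qed
  have Mx: "M *\<^sub>v x = Re \<mu> \<cdot>\<^sub>v x - Im \<mu> \<cdot>\<^sub>v y"
  proof (rule eq_vecI)
    fix i assume "i < dim_vec (Re \<mu> \<cdot>\<^sub>v x - Im \<mu> \<cdot>\<^sub>v y)"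
    then have i: "i < n" using xy by simp
    show "(M *\<^sub>v x) $ i = (Re \<mu> \<cdot>\<^sub>v x - Im \<mu> \<cdot>\<^sub>v y) $ i"
      using M w i arg_cong[OF comp[OF i], of Re]
      by (simp add: scalar_prod_def lessThan_atLeast0 x_def y_def)
  qed (use M xy in auto)
  have My: "M *\<^sub>v y = Im \<mu> \<cdot>\<^sub>v x + Re \<mu> \<cdot>\<^sub>v y"
  proof (rule eq_vecI)
    fix i assume "i < dim_vec (Im \<mu> \<cdot>\<^sub>v x + Re \<mu> \<cdot>\<^sub>v y)"
    then have i: "i < n" using xy by simp
    show "(M *\<^sub>v y) $ i = (Im \<mu> \<cdot>\<^sub>v x + Re \<mu> \<cdot>\<^sub>v y) $ i"
      using M w i arg_cong[OF comp[OF i], of Im]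
      by (simp add: scalar_prod_def lessThan_atLeast0 x_def y_def)
  qed (use M xy in auto)
  have nz: "x \<noteq> 0\<^sub>v n \<or> y \<noteq> 0\<^sub>v n"
  proof (rule ccontr)
    assume *: "\<not> ?thesis"
    have "w = 0\<^sub>v n"
    proof (rule eq_vecI)
      fix i assume "i < dim_vec (0\<^sub>v n :: complex vec)"
      then have i: "i < n" by simp
      have "x $ i = 0" "y $ i = 0" using * i by auto
      then show "w $ i = 0\<^sub>v n $ i" using i w by (simp add: x_def y_def complex_eq_iff)
    qed (use w in auto)
    then show False using w by simp
  qed
  have "scalar_prod (M *\<^sub>v x) y = scalar_prod x (M *\<^sub>v y)"
    using symmetric_scalar_prod M sym xy by blast
  then have "Im \<mu> * (scalar_prod x x + scalar_prod y y) = 0"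
    using xy comm_scalar_prod[of x n y]
    by (simp add: Mx My minus_scalar_prod_distrib[of _ n] scalar_prod_add_distrib[of _ n] algebra_simps)
  moreover have "scalar_prod x x + scalar_prod y y > 0"
    using nz xy scalar_prod_real_pos[of x n] scalar_prod_real_pos[of y n]
      scalar_prod_real_nonneg[of x] scalar_prod_real_nonneg[of y] by linarith
  ultimately have im: "Im \<mu> = 0" by simp
  have ex: "M *\<^sub>v x = Re \<mu> \<cdot>\<^sub>v x" using Mx im xy by auto
  have ey: "M *\<^sub>v y = Re \<mu> \<cdot>\<^sub>v y" using My im xy by auto
  from nz ex ey xy that show ?thesis by blast
qed

definition orthonormal_mat where
  "orthonormal_mat n U \<longleftrightarrow> U \<in> carrier_mat n n \<and> U\<^sup>T * U = 1\<^sub>m n \<and> U * U\<^sup>T = (1\<^sub>m n :: real mat)"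

lemma orthonormal_mat_mult:
  assumes "orthonormal_mat n U" "orthonormal_mat n V"
  shows "orthonormal_mat n (U * V)"
proof -
  have c: "U \<in> carrier_mat n n" "V \<in> carrier_mat n n"
    and u: "U\<^sup>T * U = 1\<^sub>m n" "U * U\<^sup>T = 1\<^sub>m n" "V\<^sup>T * V = 1\<^sub>m n" "V * V\<^sup>T = 1\<^sub>m n"
    using assms by (auto simp: orthonormal_mat_def)
  have "(U * V)\<^sup>T * (U * V) = V\<^sup>T * (U\<^sup>T * U) * V"
    using c by (simp add: transpose_mult_dim mult_assoc_dim del: assoc_mult_mat)
  moreover have "(U * V) * (U * V)\<^sup>T = U * (V * V\<^sup>T) * U\<^sup>T"
    using c by (simp add: transpose_mult_dim mult_assoc_dim del: assoc_mult_mat)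
  ultimately show ?thesis using c u by (simp add: orthonormal_mat_def)
qed

text \<open>The Householder reflection exchanging the unit vectors \<open>e\<^sub>0\<close> and \<open>v\<close>.\<close>

lemma orthonormal_mat_first_col:
  fixes v :: "real vec"
  assumes v: "v \<in> carrier_vec n" and vv: "scalar_prod v v = 1" and n: "n > 0"
  obtains Q where "orthonormal_mat n Q" "col Q 0 = v"
proof (cases "v = unit_vec n 0")
  \<comment> \<open>Here the reflection vector \<open>v - e_0\<close> would be zero, so the identity
    is used instead.\<close>
  case True
  have "orthonormal_mat n (1\<^sub>m n)" by (simp add: orthonormal_mat_def)
  moreover have "col (1\<^sub>m n) 0 = v" using True n by auto
  ultimately show ?thesis using that by blast
next
  case False
  define u where "u = v - unit_vec n 0"
  define s where "s = scalar_prod u u"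
  have u: "u \<in> carrier_vec n" using v by (simp add: u_def)
  have "u \<noteq> 0\<^sub>v n"
  proof
    assume *: "u = 0\<^sub>v n"
    have "v = unit_vec n 0"
    proof (rule eq_vecI)
      fix i assume "i < dim_vec (unit_vec n 0 :: real vec)"
      then have i: "i < n" by simp
      have "u $ i = 0" using * i by simp
      then show "v $ i = unit_vec n 0 $ i" using i v by (simp add: u_def)
    qed (use v in auto)
    with False show False by simp
  qed
  then have s0: "s > 0" using scalar_prod_real_pos u s_def by blast
  \<comment> \<open>Both \<open>v\<close> and \<open>e_0\<close> have norm 1. Hence
    \<open>u $ 0 = v $ 0 - 1 = - s / 2\<close>, which is what makes the first column of the
    reflection equal to \<open>e_0 + u = v\<close>.\<close>
  have s: "s = 2 - 2 * v $ 0"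
    using v n vv unfolding s_def u_def
    by (simp add: minus_scalar_prod_distrib[of _ n] scalar_prod_minus_distrib[of _ n])
  have us: "(\<Sum>k<n. u $ k * u $ k) = s" using u by (simp add: s_def scalar_prod_def lessThan_atLeast0)
  define Q where "Q = mat n n (\<lambda>(i, j). (if i = j then 1 else 0) - 2 / s * (u $ i * u $ j))"
  have Q: "Q \<in> carrier_mat n n" by (simp add: Q_def)
  have QT: "Q\<^sup>T = Q" by (rule eq_matI) (auto simp: Q_def)
  have QQ: "Q * Q = 1\<^sub>m n"
  proof (rule eq_matI)
    fix i j assume "i < dim_row (1\<^sub>m n :: real mat)" "j < dim_col (1\<^sub>m n :: real mat)"
    then have ij: "i < n" "j < n" by auto
    define e where "e = 2 / s * (u $ i * u $ j)"
    define c where "c = 4 / s\<^sup>2 * (u $ i * u $ j)"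
    have "(Q * Q) $$ (i, j) = (\<Sum>k<n. ((if i = k then 1 else 0) - 2 / s * (u $ i * u $ k)) *
        ((if k = j then 1 else 0) - 2 / s * (u $ k * u $ j)))"
      using ij by (simp add: Q_def scalar_prod_def lessThan_atLeast0)
    \<comment> \<open>The two cross terms contribute \<open>- e\<close> each, and the quadratic term
      sums to \<open>c * s = 2 * e\<close>, so they cancel.\<close>
    also have "\<dots> = (\<Sum>k<n. (if k = i then (if i = j then 1 else 0) - e else 0)
        - (if k = j then e else 0) + c * (u $ k * u $ k))"
      by (rule sum.cong) (auto simp: c_def e_def algebra_simps power2_eq_square)
    also have "\<dots> = (if i = j then 1 else 0) - e - e + c * s"
      using ij by (simp add: sum.distrib sum_subtractf sum_distrib_left[symmetric] us)
    also have "\<dots> = (if i = j then 1 else 0)"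
      using s0 by (simp add: c_def e_def field_simps power2_eq_square)
    finally show "(Q * Q) $$ (i, j) = 1\<^sub>m n $$ (i, j)" using ij by simp
  qed (use Q in auto)
  have "col Q 0 = v"
  proof (rule eq_vecI)
    fix i assume "i < dim_vec v"
    then have i: "i < n" using v by simp
    have "u $ 0 = - s / 2" using s n v by (simp add: u_def)
    then have "col Q 0 $ i = (if i = 0 then 1 else 0) + u $ i"
      using i n s0 by (simp add: Q_def)
    also have "\<dots> = v $ i" using i n v by (simp add: u_def)
    finally show "col Q 0 $ i = v $ i" .
  qed (use Q v in auto)
  moreover have "orthonormal_mat n Q" using Q QT QQ by (simp add: orthonormal_mat_def)
  ultimately show ?thesis using that by blast
qed

text \<open>Deflation: complete a unit eigenvector to an orthonormal basis \<open>Q\<close>. In that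
  basis \<open>M\<close> splits into the eigenvalue and a symmetric block of size one less, to which
  the induction hypothesis applies.\<close>

theorem symmetric_diagonalization:
  fixes M :: "real mat"
  assumes "M \<in> carrier_mat n n" "M\<^sup>T = M"
  shows "\<exists>U d. orthonormal_mat n U \<and> M = U * mat_diag n d * U\<^sup>T"
  using assms
proof (induction n arbitrary: M)
  case 0
  then have "M = 1\<^sub>m 0 * mat_diag 0 d * (1\<^sub>m 0)\<^sup>T" for d by (intro eq_matI) auto
  moreover have "orthonormal_mat 0 (1\<^sub>m 0)" by (simp add: orthonormal_mat_def)
  ultimately show ?case by blast
next
  case (Suc k)
  let ?n = "Suc k"
  note M = Suc.prems(1) and sym = Suc.prems(2)
  obtain w l where w: "w \<in> carrier_vec ?n" "w \<noteq> 0\<^sub>v ?n" "M *\<^sub>v w = l \<cdot>\<^sub>v w"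
    using symmetric_real_eigenvector[OF M sym] by auto
  define v where "v = (1 / sqrt (scalar_prod w w)) \<cdot>\<^sub>v w"
  have v: "v \<in> carrier_vec ?n" using w by (simp add: v_def)
  have Mv: "M *\<^sub>v v = l \<cdot>\<^sub>v v"
    using w M by (simp add: v_def mult_mat_vec[of _ ?n ?n] smult_smult_assoc mult.commute)
  have "scalar_prod w w > 0" using scalar_prod_real_pos w by blast
  then have vv: "scalar_prod v v = 1" using w by (simp add: v_def)
  obtain Q where Q: "orthonormal_mat ?n Q" "col Q 0 = v"
    using orthonormal_mat_first_col[OF v vv] by auto
  then have Qc: "Q \<in> carrier_mat ?n ?n" and QTQ: "Q\<^sup>T * Q = 1\<^sub>m ?n" and QQT: "Q * Q\<^sup>T = 1\<^sub>m ?n"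
    by (auto simp: orthonormal_mat_def)
  define N where "N = Q\<^sup>T * M * Q"
  have N: "N \<in> carrier_mat ?n ?n" using Qc M by (simp add: N_def)
  have NT: "N\<^sup>T = N" using Qc M sym by (simp add: N_def transpose_mult_dim mult_assoc_dim)
  \<comment> \<open>The first column of \<open>Q\<close> is an eigenvector and is orthogonal to the
    other columns.\<close>
  have col: "N $$ (i, 0) = (if i = 0 then l else 0)" if i: "i < ?n" for i
  proof -
    have "N $$ (i, 0) = scalar_prod (col Q i) (M *\<^sub>v col Q 0)"
    proof -
      have "N = Q\<^sup>T * (M * Q)" using Qc M by (simp add: N_def)
      then show ?thesis using Qc M i by (simp add: mult_mat_vec_def)
    qed
    also have "\<dots> = l * scalar_prod (col Q i) (col Q 0)"
      using Mv Q(2) v Qc i by (simp add: scalar_prod_smult_distrib[of _ ?n])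
    also have "scalar_prod (col Q i) (col Q 0) = (Q\<^sup>T * Q) $$ (i, 0)" using Qc i by simp
    finally show ?thesis using QTQ i by simp
  qed
  have row: "N $$ (0, i) = (if i = 0 then l else 0)" if i: "i < ?n" for i
    using col[OF i] NT N i by (metis carrier_matD index_transpose_mat(1) zero_less_Suc)
  define N' where "N' = mat k k (\<lambda>(i, j). N $$ (Suc i, Suc j))"
  have N': "N' \<in> carrier_mat k k" by (simp add: N'_def)
  have "N'\<^sup>T = N'"
  proof (rule eq_matI)
    fix i j assume "i < dim_row N'" "j < dim_col N'"
    then have ij: "Suc i < ?n" "Suc j < ?n" "i < k" "j < k" by (auto simp: N'_def)
    have "N $$ (Suc j, Suc i) = N $$ (Suc i, Suc j)"
      using NT N ij by (metis carrier_matD index_transpose_mat(1))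
    then show "N'\<^sup>T $$ (i, j) = N' $$ (i, j)" using ij by (simp add: N'_def)
  qed (auto simp: N'_def)
  with Suc.IH[OF N'] obtain U' d' where
    U': "orthonormal_mat k U'" "N' = U' * mat_diag k d' * U'\<^sup>T" by blast
  then have U'c: "U' \<in> carrier_mat k k" and U'U: "U'\<^sup>T * U' = 1\<^sub>m k" "U' * U'\<^sup>T = 1\<^sub>m k"
    by (auto simp: orthonormal_mat_def)
  \<comment> \<open>\<open>V\<close> fixes the eigenvector already found and acts as
    \<open>U'\<close> on its complement, so it diagonalizes \<open>N\<close>, and
    \<open>Q * V\<close> diagonalizes \<open>M\<close>.\<close>
  define V where "V = four_block_mat (1\<^sub>m 1) (0\<^sub>m 1 k) (0\<^sub>m k 1) U'"
  define d where "d = (\<lambda>i. case i of 0 \<Rightarrow> l | Suc j \<Rightarrow> d' j)"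
  have VT: "V\<^sup>T = four_block_mat (1\<^sub>m 1) (0\<^sub>m 1 k) (0\<^sub>m k 1) (U'\<^sup>T)"
    unfolding V_def using U'c by (simp add: transpose_four_block_mat[of _ 1 1 _ k _ k])
  have Vc: "V \<in> carrier_mat ?n ?n" using U'c by (auto simp: V_def intro!: carrier_matI)
  have V: "orthonormal_mat ?n V"
    using Vc U'c U'U four_block_one_mat[of 1 k]
    by (simp add: orthonormal_mat_def VT)
       (simp add: V_def mult_four_block_mat[of _ 1 1 _ k _ k _ _ 1 _ k] )
  have D: "mat_diag ?n d = four_block_mat (l \<cdot>\<^sub>m 1\<^sub>m 1) (0\<^sub>m 1 k) (0\<^sub>m k 1) (mat_diag k d')"
    by (rule eq_matI) (auto simp: mat_diag_def d_def split: nat.splits)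
  have NB: "N = four_block_mat (l \<cdot>\<^sub>m 1\<^sub>m 1) (0\<^sub>m 1 k) (0\<^sub>m k 1) N'"
    by (rule eq_matI) (use N row col in \<open>auto simp: N'_def\<close>)
  have dk: "mat_diag k d' \<in> carrier_mat k k" "0\<^sub>m (Suc 0) k * mat_diag k d' = 0\<^sub>m (Suc 0) k"
      "U' * mat_diag k d' * 0\<^sub>m k (Suc 0) = 0\<^sub>m k (Suc 0)" "U' * mat_diag k d' * U'\<^sup>T \<in> carrier_mat k k"
    using U'c N' U'(2) left_mult_zero_mat[OF mat_diag_dim, of "Suc 0" k d']
      right_mult_zero_mat[of "U' * mat_diag k d'" k k "Suc 0"] by simp_all
  have "V * mat_diag ?n d * V\<^sup>T = N"
    unfolding NB D VT unfolding V_def using U'c dk U'(2)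
    by (simp add: mult_four_block_mat[of _ 1 1 _ k _ k _ _ 1 _ k])
  moreover have "Q * N * Q\<^sup>T = M"
  proof -
    have "Q * N * Q\<^sup>T = (Q * Q\<^sup>T) * M * (Q * Q\<^sup>T)"
      using Qc M by (simp add: N_def mult_assoc_dim)
    then show ?thesis using QQT M by simp
  qed
  moreover note Vc
  moreover have "dim_row (mat_diag ?n d) = ?n" "dim_col (mat_diag ?n d) = ?n"
    using mat_diag_dim[of ?n d] by (auto simp del: mat_diag_dim)
  ultimately have "(Q * V) * mat_diag ?n d * (Q * V)\<^sup>T = M"
    using Qc by (auto simp: transpose_mult_dim mult_assoc_dim)
  then show ?case using orthonormal_mat_mult[OF Q(1) V] by metis
qed

section \<open>Functional calculus in a fixed orthonormal eigenbasis\<close>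

text \<open>For fixed orthonormal \<open>U\<close> this respects sums and products of
  \<open>f\<close>, so inverses, square roots and pseudoinverses reduce to operations on single
  eigenvalues.\<close>

definition conj_diag :: "nat \<Rightarrow> real mat \<Rightarrow> (nat \<Rightarrow> real) \<Rightarrow> real mat" where
  "conj_diag n U f = U * mat_diag n f * U\<^sup>T"

lemma symmetric_conj_diag:
  assumes "M \<in> carrier_mat n n" "M\<^sup>T = M"
  obtains U d where "orthonormal_mat n U" "M = conj_diag n U d"
  using symmetric_diagonalization[OF assms] by (auto simp: conj_diag_def)

lemma dim_mat_diag [simp]: "dim_row (mat_diag n f) = n" "dim_col (mat_diag n f) = n"
  by (auto simp: mat_diag_def)

lemma mat_diag_mult_vec:
  fixes y :: "'a :: semiring_0 vec"
  assumes y: "y \<in> carrier_vec n"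
  shows "mat_diag n f *\<^sub>v y = vec n (\<lambda>i. f i * y $ i)"
proof (rule eq_vecI)
  fix i assume "i < dim_vec (vec n (\<lambda>i. f i * y $ i))"
  then have i: "i < n" by simp
  then have "(mat_diag n f *\<^sub>v y) $ i = (\<Sum>j<n. (if i = j then f j else 0) * y $ j)"
    using y by (simp add: mat_diag_def scalar_prod_def lessThan_atLeast0)
  also have "\<dots> = (\<Sum>j<n. if j = i then f i * y $ i else 0)"
    by (rule sum.cong) auto
  finally show "(mat_diag n f *\<^sub>v y) $ i = vec n (\<lambda>i. f i * y $ i) $ i" using i by simp
qed simp

context
  fixes n :: nat and U :: "real mat"
  assumes U: "orthonormal_mat n U"
begin

lemma orthogonal_carrier: "U \<in> carrier_mat n n"
  and orthogonal_inverse: "U\<^sup>T * U = 1\<^sub>m n" "U * U\<^sup>T = 1\<^sub>m n"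
  using U by (auto simp: orthonormal_mat_def)

lemma conj_diag_carrier: "conj_diag n U f \<in> carrier_mat n n"
  using orthogonal_carrier by (auto simp: conj_diag_def)

lemma conj_diag_transpose: "(conj_diag n U f)\<^sup>T = conj_diag n U f"
proof -
  have "(mat_diag n f)\<^sup>T = mat_diag n f" by (rule eq_matI) (auto simp: mat_diag_def)
  then show ?thesis using orthogonal_carrier
    by (simp add: conj_diag_def transpose_mult_dim mult_assoc_dim)
qed

lemma conj_diag_mult: "conj_diag n U f * conj_diag n U g = conj_diag n U (\<lambda>i. f i * g i)"
proof -
  have "conj_diag n U f * conj_diag n U g = U * mat_diag n f * (U\<^sup>T * U) * mat_diag n g * U\<^sup>T"
    using orthogonal_carrier
    by (simp add: conj_diag_def mult_assoc_dim)
  also have "\<dots> = U * (mat_diag n f * mat_diag n g) * U\<^sup>T"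
    using orthogonal_carrier by (simp add: orthogonal_inverse mult_assoc_dim del: mat_diag_diag)
  finally show ?thesis by (simp add: conj_diag_def)
qed

lemma conj_diag_index:
  assumes "i < n" "j < n"
  shows "conj_diag n U f $$ (i, j) = (\<Sum>k<n. U $$ (i, k) * f k * U $$ (j, k))"
  using assms orthogonal_carrier
  by (simp add: conj_diag_def mat_diag_mult_right[OF orthogonal_carrier] scalar_prod_def lessThan_atLeast0)

lemma conj_diag_cong: "(\<And>i. i < n \<Longrightarrow> f i = g i) \<Longrightarrow> conj_diag n U f = conj_diag n U g"
  using conj_diag_carrier[of f] conj_diag_carrier[of g]
  by (intro eq_matI) (auto simp: conj_diag_index)

lemma conj_diag_one: "conj_diag n U (\<lambda>_. 1) = 1\<^sub>m n"
  using orthogonal_carrier by (simp add: conj_diag_def orthogonal_inverse)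

lemma conj_diag_add: "conj_diag n U f + conj_diag n U g = conj_diag n U (\<lambda>i. f i + g i)"
  using conj_diag_carrier[of f] conj_diag_carrier[of g] conj_diag_carrier[of "\<lambda>i. f i + g i"]
  by (intro eq_matI) (auto simp: conj_diag_index algebra_simps sum.distrib)

lemma conj_diag_mult_col:
  assumes "i < n"
  shows "conj_diag n U f *\<^sub>v col U i = f i \<cdot>\<^sub>v col U i"
proof -
  have "conj_diag n U f * U = U * mat_diag n f"
    using orthogonal_carrier
    by (simp add: conj_diag_def mult_assoc_dim orthogonal_inverse)
  then have "col (conj_diag n U f * U) i = col (U * mat_diag n f) i" by simp
  moreover have "col (conj_diag n U f * U) i = conj_diag n U f *\<^sub>v col U i"
    using conj_diag_carrier[of f] orthogonal_carrier assms by (intro col_mult2) auto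
  moreover have "col (U * mat_diag n f) i = f i \<cdot>\<^sub>v col U i"
    using orthogonal_carrier assms by (auto simp: mat_diag_mult_right[OF orthogonal_carrier])
  ultimately show ?thesis by simp
qed

lemma orthogonal_col_norm: "i < n \<Longrightarrow> scalar_prod (col U i) (col U i) = 1"
  using orthogonal_inverse(1) orthogonal_carrier
  by (metis carrier_matD index_mult_mat(1) index_one_mat(1) index_transpose_mat(2) row_transpose)

lemma orthogonal_col_nonzero: "i < n \<Longrightarrow> col U i \<noteq> 0\<^sub>v n"
  using orthogonal_col_norm[of i] by auto

text \<open>Moving \<open>U\<close> across the scalar product leaves a diagonal form in
  \<open>U\<^sup>T *\<^sub>v x\<close>, the coordinates of \<open>x\<close> in the
  eigenbasis.\<close>

lemma conj_diag_quadratic_form: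
  assumes x: "x \<in> carrier_vec n"
  shows "scalar_prod x (conj_diag n U f *\<^sub>v x) = (\<Sum>i<n. f i * (scalar_prod (col U i) x)\<^sup>2)"
proof -
  have "conj_diag n U f *\<^sub>v x = U *\<^sub>v (mat_diag n f *\<^sub>v (U\<^sup>T *\<^sub>v x))"
    using orthogonal_carrier x by (simp add: conj_diag_def mult_vec_assoc_dim del: assoc_mult_mat_vec)
  then have "scalar_prod x (conj_diag n U f *\<^sub>v x)
      = scalar_prod (U\<^sup>T *\<^sub>v x) (mat_diag n f *\<^sub>v (U\<^sup>T *\<^sub>v x))"
    using transpose_vec_mult_scalar[OF orthogonal_carrier, of "mat_diag n f *\<^sub>v (U\<^sup>T *\<^sub>v x)" x]
      orthogonal_carrier x by (simp add: mult_mat_vec_carrier[of _ n n])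
  also have "\<dots> = scalar_prod (U\<^sup>T *\<^sub>v x) (vec n (\<lambda>i. f i * (U\<^sup>T *\<^sub>v x) $ i))"
    using orthogonal_carrier x by (subst mat_diag_mult_vec) (auto intro: mult_mat_vec_carrier)
  also have "\<dots> = (\<Sum>i<n. (U\<^sup>T *\<^sub>v x) $ i * (f i * (U\<^sup>T *\<^sub>v x) $ i))"
    by (simp add: scalar_prod_def lessThan_atLeast0)
  also have "\<dots> = (\<Sum>i<n. f i * (scalar_prod (col U i) x)\<^sup>2)"
    using orthogonal_carrier by (intro sum.cong) (auto simp: power2_eq_square)
  finally show ?thesis .
qed

lemma spd_conj_diag_iff: "spd_mat n (conj_diag n U f) \<longleftrightarrow> (\<forall>i<n. f i > 0)"
proof
  assume *: "spd_mat n (conj_diag n U f)"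
  show "\<forall>i<n. f i > 0"
  proof (intro allI impI)
    fix i assume i: "i < n"
    have c: "col U i \<in> carrier_vec n" using orthogonal_carrier i by auto
    have "scalar_prod (col U i) (conj_diag n U f *\<^sub>v col U i) > 0"
      using * c orthogonal_col_nonzero[OF i] by (auto simp: spd_mat_def)
    then show "f i > 0" using c orthogonal_col_norm[OF i]
      by (simp add: conj_diag_mult_col[OF i])
  qed
next
  assume f: "\<forall>i<n. f i > 0"
  have "scalar_prod x (conj_diag n U f *\<^sub>v x) > 0" if x: "x \<in> carrier_vec n" "x \<noteq> 0\<^sub>v n" for x
  proof -
    \<comment> \<open>Parseval, read off the quadratic form with all eigenvalues 1: a nonzero
      \<open>x\<close> has a nonzero coordinate, which makes the weighted sum strictly
      positive.\<close>
    have "scalar_prod x x = (\<Sum>i<n. 1 * (scalar_prod (col U i) x)\<^sup>2)"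
      using conj_diag_quadratic_form[OF x(1), of "\<lambda>_. 1"] x by (simp add: conj_diag_one)
    then have "(\<Sum>i<n. (scalar_prod (col U i) x)\<^sup>2) \<noteq> 0" using scalar_prod_real_pos[OF x] by simp
    then obtain i where "i < n" "scalar_prod (col U i) x \<noteq> 0"
      by (metis (no_types, lifting) lessThan_iff sum.neutral zero_power2)
    then show ?thesis using f
      by (subst conj_diag_quadratic_form[OF x(1)])
         (auto intro!: sum_pos2[of _ i] simp: less_imp_le)
  qed
  then show "spd_mat n (conj_diag n U f)"
    by (auto simp: spd_mat_def conj_diag_carrier conj_diag_transpose)
qed

end

section \<open>Inverse and square root of positive definite matrices\<close>

lemma inv_mat_eqI:
  assumes A: "A \<in> carrier_mat n n" and X: "X \<in> carrier_mat n n"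
    and AX: "A * X = 1\<^sub>m n" and XA: "X * A = 1\<^sub>m n"
  shows "inv_mat A = X"
proof (cases "mat_inverse A")
  case None
  then have "A \<notin> Units (ring_mat TYPE(real) n ())" using mat_inverse(1)[OF A, of "()"] by blast
  then show ?thesis using A X AX XA by (auto simp: Units_def ring_mat_def)
next
  case (Some Y)
  then have Y: "A * Y = 1\<^sub>m n" "Y \<in> carrier_mat n n" using mat_inverse(2)[OF A] by auto
  have "X = X * (A * Y)" using X Y by simp
  also have "\<dots> = X * A * Y" using X A Y by simp
  finally show ?thesis using Some XA Y by (simp add: inv_mat_def)
qed

lemma spd_inv_mat:
  assumes "spd_mat n B"
  shows "inv_mat B \<in> carrier_mat n n" "B * inv_mat B = 1\<^sub>m n" "inv_mat B * B = 1\<^sub>m n"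
    "(inv_mat B)\<^sup>T = inv_mat B"
proof -
  obtain U d where U: "orthonormal_mat n U" and B: "B = conj_diag n U d"
    using symmetric_conj_diag assms unfolding spd_mat_def by metis
  have d: "\<forall>i<n. d i > 0" using assms spd_conj_diag_iff[OF U] B by simp
  define X where "X = conj_diag n U (\<lambda>i. 1 / d i)"
  have "conj_diag n U (\<lambda>i. d i * (1 / d i)) = 1\<^sub>m n" "conj_diag n U (\<lambda>i. 1 / d i * d i) = 1\<^sub>m n"
    using conj_diag_one[OF U] d conj_diag_cong[OF U, of "\<lambda>i. d i * (1 / d i)" "\<lambda>_. 1"]
      conj_diag_cong[OF U, of "\<lambda>i. 1 / d i * d i" "\<lambda>_. 1"] by force+
  then have BX: "B * X = 1\<^sub>m n" "X * B = 1\<^sub>m n"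
    by (simp_all add: B X_def conj_diag_mult[OF U])
  have X: "X \<in> carrier_mat n n" "X\<^sup>T = X"
    using conj_diag_carrier[OF U] conj_diag_transpose[OF U] by (auto simp: X_def)
  have "inv_mat B = X" using inv_mat_eqI BX X assms by (auto simp: spd_mat_def)
  with BX X show "inv_mat B \<in> carrier_mat n n" "B * inv_mat B = 1\<^sub>m n" "inv_mat B * B = 1\<^sub>m n"
    "(inv_mat B)\<^sup>T = inv_mat B" by auto
qed

text \<open>Let \<open>v\<close> be an eigenvector of \<open>S - R\<close> with eigenvalue
  \<open>d\<close>. Equal squares give \<open>Sv\<close> and \<open>Rv\<close> the same norm, so
  \<open>Sv - Rv = d v\<close> is orthogonal to \<open>Sv + Rv\<close>. Since
  \<open>v.Sv + v.Rv\<close> is positive, \<open>d = 0\<close>. A symmetric matrix all of whose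
  eigenvalues vanish is zero.\<close>

lemma spd_sqrt_unique:
  assumes S: "spd_mat n S" and R: "spd_mat n R" and eq: "S * S = R * R"
  shows "S = R"
proof -
  have c: "S \<in> carrier_mat n n" "R \<in> carrier_mat n n" "S\<^sup>T = S" "R\<^sup>T = R"
    using S R by (auto simp: spd_mat_def)
  have "(S - R)\<^sup>T = S - R" using c by (simp add: transpose_minus[of _ n n])
  then obtain U d where U: "orthonormal_mat n U" and D: "S - R = conj_diag n U d"
    using symmetric_conj_diag[of "S - R" n] c by (metis minus_carrier_mat)
  have "d i = 0" if i: "i < n" for i
  proof -
    define v where "v = col U i"
    have v: "v \<in> carrier_vec n" "v \<noteq> 0\<^sub>v n"
      using orthogonal_carrier[OF U] orthogonal_col_nonzero[OF U i] i by (auto simp: v_def)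
    have Sv: "S *\<^sub>v v \<in> carrier_vec n" "R *\<^sub>v v \<in> carrier_vec n" using c v by auto
    have SRv: "S *\<^sub>v v - R *\<^sub>v v = d i \<cdot>\<^sub>v v"
      using conj_diag_mult_col[OF U i, of d] minus_mult_distrib_mat_vec[OF c(1,2) v(1)] D v_def by metis
    have "scalar_prod (S *\<^sub>v v) (S *\<^sub>v v) = scalar_prod v (S * S *\<^sub>v v)"
      using symmetric_scalar_prod[OF c(1,3) v(1) Sv(1)] c v by simp
    also have "\<dots> = scalar_prod (R *\<^sub>v v) (R *\<^sub>v v)"
      using symmetric_scalar_prod[OF c(2,4) v(1) Sv(2)] c v eq by simp
    finally have SR: "scalar_prod (S *\<^sub>v v) (S *\<^sub>v v) = scalar_prod (R *\<^sub>v v) (R *\<^sub>v v)" .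
    have "0 = scalar_prod (S *\<^sub>v v - R *\<^sub>v v) (S *\<^sub>v v + R *\<^sub>v v)"
      using SR Sv comm_scalar_prod[OF Sv]
      by (simp add: minus_scalar_prod_distrib[of _ n] scalar_prod_add_distrib[of _ n])
    also have "\<dots> = d i * (scalar_prod v (S *\<^sub>v v) + scalar_prod v (R *\<^sub>v v))"
      using SRv Sv v by (simp add: scalar_prod_add_distrib[of _ n] distrib_left)
    finally have "d i * (scalar_prod v (S *\<^sub>v v) + scalar_prod v (R *\<^sub>v v)) = 0" by simp
    moreover have "scalar_prod v (S *\<^sub>v v) + scalar_prod v (R *\<^sub>v v) > 0"
      using S R v by (simp add: spd_mat_def add_pos_pos)
    ultimately show "d i = 0" by simp
  qed
  then have "S - R = 0\<^sub>m n n"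
    unfolding D using conj_diag_carrier[OF U, of d] by (intro eq_matI) (auto simp: conj_diag_index[OF U])
  moreover have "S = (S - R) + R" using c by (intro eq_matI) auto
  ultimately show ?thesis using c by (metis left_add_zero_mat)
qed

text \<open>This resolves the definite description: roots of the eigenvalues give existence, and
  \<open>spd_sqrt_unique\<close> gives uniqueness.\<close>

lemma spd_sqrt_mat:
  assumes "spd_mat n B"
  shows "spd_mat n (sqrt_mat B)" "sqrt_mat B * sqrt_mat B = B"
proof -
  obtain U d where U: "orthonormal_mat n U" and B: "B = conj_diag n U d"
    using symmetric_conj_diag assms unfolding spd_mat_def by metis
  have d: "\<forall>i<n. d i > 0" using assms spd_conj_diag_iff[OF U] B by simp
  define R where "R = conj_diag n U (\<lambda>i. sqrt (d i))"
  have "spd_mat n R" using d spd_conj_diag_iff[OF U] by (simp add: R_def)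
  moreover have "R * R = B"
    unfolding R_def B conj_diag_mult[OF U] using d by (intro conj_diag_cong[OF U]) (simp add: less_imp_le)
  moreover have "dim_row B = n" using assms by (auto simp: spd_mat_def)
  ultimately have "sqrt_mat B = R"
    unfolding sqrt_mat_def by (intro the_equality) (simp, metis spd_sqrt_unique)
  with \<open>spd_mat n R\<close> \<open>R * R = B\<close>
  show "spd_mat n (sqrt_mat B)" "sqrt_mat B * sqrt_mat B = B" by auto
qed

section \<open>Moore-Penrose inverses\<close>

lemma is_mp_inverse_unique:
  assumes X: "is_mp_inverse M X" and Y: "is_mp_inverse M Y"
  shows "X = Y"
proof -
  have d: "dim_row X = dim_col M" "dim_col X = dim_row M" "dim_row Y = dim_col M" "dim_col Y = dim_row M"
    using X Y by (auto simp: is_mp_inverse_def)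
  \<comment> \<open>\<open>M * X\<close> and \<open>M * Y\<close> are symmetric, so transposing
    their product swaps the factors, and \<open>M * X * M = M\<close> then absorbs \<open>X\<close>.
    The same argument on the other side gives \<open>X * M = Y * M\<close>, and
    \<open>X = X * M * X\<close> turns into \<open>Y\<close> by replacing both products.\<close>
  have "M * X = (M * Y * M) * X" using Y by (simp add: is_mp_inverse_def)
  also have "\<dots> = (M * Y) * (M * X)" using d by (simp add: mult_assoc_dim)
  also have "\<dots> = (M * Y)\<^sup>T * (M * X)\<^sup>T" using X Y by (simp add: is_mp_inverse_def)
  also have "\<dots> = ((M * X) * (M * Y))\<^sup>T" using d by (intro transpose_mult_dim[symmetric]) simp
  also have "(M * X) * (M * Y) = (M * X * M) * Y" using d by (simp add: mult_assoc_dim)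
  also have "\<dots> = M * Y" using X by (simp add: is_mp_inverse_def)
  also have "(M * Y)\<^sup>T = M * Y" using Y by (simp add: is_mp_inverse_def)
  finally have MX: "M * X = M * Y" .
  have "X * M = X * (M * Y * M)" using Y by (simp add: is_mp_inverse_def)
  also have "\<dots> = (X * M) * (Y * M)" using d by (simp add: mult_assoc_dim)
  also have "\<dots> = (X * M)\<^sup>T * (Y * M)\<^sup>T" using X Y by (simp add: is_mp_inverse_def)
  also have "\<dots> = ((Y * M) * (X * M))\<^sup>T" using d by (intro transpose_mult_dim[symmetric]) simp
  also have "(Y * M) * (X * M) = Y * (M * X * M)" using d by (simp add: mult_assoc_dim)
  also have "\<dots> = Y * M" using X by (simp add: is_mp_inverse_def)
  also have "(Y * M)\<^sup>T = Y * M" using Y by (simp add: is_mp_inverse_def)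
  finally have XM: "X * M = Y * M" .
  have "X = X * M * X" using X by (simp add: is_mp_inverse_def)
  also have "\<dots> = Y * M * X" using XM by simp
  also have "\<dots> = Y * (M * X)" using d by (simp add: mult_assoc_dim)
  also have "\<dots> = Y * M * Y" using d MX by (simp add: mult_assoc_dim)
  also have "\<dots> = Y" using Y by (simp add: is_mp_inverse_def)
  finally show ?thesis .
qed

lemma symmetric_mp_inverse:
  assumes M: "M \<in> carrier_mat n n" "M\<^sup>T = M"
  shows "is_mp_inverse M (mp_inverse M)" "(mp_inverse M)\<^sup>T = mp_inverse M"
    "mp_inverse M * M = M * mp_inverse M"
proof -
  obtain U d where U: "orthonormal_mat n U" and Md: "M = conj_diag n U d"
    using symmetric_conj_diag M by metis
  \<comment> \<open>Since \<open>inverse 0 = 0\<close>, this inverts the nonzero eigenvalues and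
    keeps the zero ones, as a pseudoinverse must.\<close>
  define X where "X = conj_diag n U (\<lambda>i. inverse (d i))"
  have d: "d i * inverse (d i) * d i = d i" "inverse (d i) * d i * inverse (d i) = inverse (d i)" for i
    by (cases "d i = 0"; simp)+
  have "M * X * M = M" "X * M * X = X"
    unfolding X_def Md conj_diag_mult[OF U] d by (rule refl)+
  moreover have comm: "X * M = M * X"
    unfolding X_def Md conj_diag_mult[OF U] by (simp add: mult.commute)
  moreover have "(M * X)\<^sup>T = M * X"
    unfolding X_def Md conj_diag_mult[OF U] by (rule conj_diag_transpose[OF U])
  moreover have "X \<in> carrier_mat (dim_col M) (dim_row M)"
    using conj_diag_carrier[OF U] M by (auto simp: X_def)
  ultimately have mp: "is_mp_inverse M X" by (auto simp: is_mp_inverse_def)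
  have "mp_inverse M = X"
    unfolding mp_inverse_def using mp by (intro the_equality) (auto intro: is_mp_inverse_unique)
  then show "is_mp_inverse M (mp_inverse M)" "(mp_inverse M)\<^sup>T = mp_inverse M"
    "mp_inverse M * M = M * mp_inverse M"
    using mp comm conj_diag_transpose[OF U] by (auto simp: X_def)
qed

section \<open>Orthogonal projection onto the range of a matrix\<close>

text \<open>The diagonal entries of a Gram matrix are the squared norms of the columns.\<close>

lemma gram_eq_zero:
  fixes X :: "real mat"
  assumes "X \<in> carrier_mat n q" "X\<^sup>T * X = 0\<^sub>m q q"
  shows "X = 0\<^sub>m n q"
proof (rule eq_matI)
  fix i j assume "i < dim_row (0\<^sub>m n q :: real mat)" "j < dim_col (0\<^sub>m n q :: real mat)"
  then have ij: "i < n" "j < q" by auto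
  have "(X\<^sup>T * X) $$ (j, j) = (\<Sum>k<n. X $$ (k, j) * X $$ (k, j))"
    using assms(1) ij by (simp add: scalar_prod_def lessThan_atLeast0)
  then have "(\<Sum>k<n. X $$ (k, j) * X $$ (k, j)) = 0" using assms(2) ij by simp
  then have "X $$ (i, j) * X $$ (i, j) = 0"
    using ij by (subst (asm) sum_nonneg_eq_0_iff) auto
  then show "X $$ (i, j) = 0\<^sub>m n q $$ (i, j)" using ij by simp
qed (use assms in auto)

definition range_projection :: "real mat \<Rightarrow> real mat" where
  "range_projection C = C * mp_inverse (C\<^sup>T * C) * C\<^sup>T"

text \<open>The last two claims tie the projection to \<open>C * C\<^sup>T\<close> alone: it fixes
  the range of that matrix and, factoring through it, vanishes on its kernel. They serve to identify
  the projection with a function of a matrix whose size does not involve \<open>q\<close>.\<close>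

lemma range_projection:
  assumes C: "C \<in> carrier_mat n q"
  shows "range_projection C \<in> carrier_mat n n"
    and "(range_projection C)\<^sup>T = range_projection C"
    and "range_projection C * range_projection C = range_projection C"
    and "range_projection C * (C * C\<^sup>T) = C * C\<^sup>T"
    and "\<exists>F \<in> carrier_mat n n. range_projection C = F * (C * C\<^sup>T)"
proof -
  define M where "M = C\<^sup>T * C"
  define G where "G = mp_inverse M"
  have M: "M \<in> carrier_mat q q" "M\<^sup>T = M" using C by (auto simp: M_def transpose_mult_dim)
  note mp = symmetric_mp_inverse[OF M, folded G_def]
  have G: "G \<in> carrier_mat q q" "M * G * M = M" "G * M * G = G"
    using mp(1) M by (auto simp: is_mp_inverse_def)
  have P: "range_projection C = C * G * C\<^sup>T" by (simp add: range_projection_def G_def M_def)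
  show "range_projection C \<in> carrier_mat n n" using P C G by simp
  show "(range_projection C)\<^sup>T = range_projection C"
    using C G mp(2) by (simp add: P transpose_mult_dim mult_assoc_dim del: assoc_mult_mat)
  have "range_projection C * range_projection C = C * (G * M * G) * C\<^sup>T"
    using C G(1) by (simp add: P M_def mult_assoc_dim del: assoc_mult_mat)
  then show "range_projection C * range_projection C = range_projection C" by (simp add: P G)
  \<comment> \<open>The aim is \<open>C * G * M = C\<close>. From \<open>M * N = 0\<close> it
    follows that the Gram matrix of \<open>C * N\<close> vanishes, hence so does
    \<open>C * N\<close>.\<close>
  define N where "N = G * M - 1\<^sub>m q"
  have N: "N \<in> carrier_mat q q" unfolding N_def by (rule minus_carrier_mat) simp
  have "M * N = M * (G * M) - M * 1\<^sub>m q"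
    unfolding N_def using G M by (intro mult_minus_distrib_mat[of _ q q]) auto
  also have "\<dots> = 0\<^sub>m q q" using G(1,2) M by (simp add: mult_assoc_dim[symmetric] del: assoc_mult_mat)
  finally have MN: "M * N = 0\<^sub>m q q" .
  have "(C * N)\<^sup>T * (C * N) = N\<^sup>T * (M * N)"
    using C N by (simp add: M_def transpose_mult_dim mult_assoc_dim del: assoc_mult_mat)
  also have "\<dots> = 0\<^sub>m q q" using N right_mult_zero_mat[of "N\<^sup>T" q q q] by (simp add: MN)
  finally have "C * N = 0\<^sub>m n q" by (rule gram_eq_zero[OF mult_carrier_mat[OF C N]])
  moreover have "C * N = C * (G * M) - C * 1\<^sub>m q"
    unfolding N_def using C G M by (intro mult_minus_distrib_mat[of _ n q]) auto
  moreover have "Y = (Y - C * 1\<^sub>m q) + C" if "Y \<in> carrier_mat n q" for Y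
    using that C by (intro eq_matI) auto
  moreover have "C * (G * M) \<in> carrier_mat n q" using C G(1) M(1) by auto
  ultimately have CGM: "C * (G * M) = C" using C by (metis left_add_zero_mat)
  have "range_projection C * (C * C\<^sup>T) = C * (G * M) * C\<^sup>T"
    using C G(1) by (simp add: P M_def mult_assoc_dim del: assoc_mult_mat)
  then show "range_projection C * (C * C\<^sup>T) = C * C\<^sup>T" by (simp add: CGM)
  \<comment> \<open>The witness is \<open>F = C * G * G * C\<^sup>T\<close>. As \<open>G\<close>
    commutes with \<open>M\<close>, the product contains \<open>G * M * G = G\<close> and collapses
    to the projection.\<close>
  have "(C * G * G * C\<^sup>T) * (C * C\<^sup>T) = C * G * (G * M) * C\<^sup>T"
    using C G(1) by (simp add: M_def mult_assoc_dim del: assoc_mult_mat)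
  also have "\<dots> = C * (G * M * G) * C\<^sup>T"
    using C G(1) M(1) by (subst mp(3)) (simp add: mult_assoc_dim del: assoc_mult_mat)
  finally have "range_projection C = (C * G * G * C\<^sup>T) * (C * C\<^sup>T)" by (simp add: P G(3))
  moreover have "C * G * G * C\<^sup>T \<in> carrier_mat n n" using C G(1) by auto
  ultimately show "\<exists>F \<in> carrier_mat n n. range_projection C = F * (C * C\<^sup>T)" by blast
qed

text \<open>Idempotence and symmetry make \<open>P $$ (i, i)\<close> the sum of squares of row
  \<open>i\<close>. It therefore dominates its own square, so it is at most 1, and it dominates the
  square of every entry of the row.\<close>

lemma symmetric_idempotent_entry_bound:
  fixes P :: "real mat"
  assumes P: "P \<in> carrier_mat n n" "P\<^sup>T = P" "P * P = P" and ij: "i < n" "j < n"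
  shows "\<bar>P $$ (i, j)\<bar> \<le> 1"
proof -
  have sym: "P $$ (k, i) = P $$ (i, k)" if "k < n" for k
    using that P ij by (metis carrier_matD index_transpose_mat(1))
  have "P $$ (i, i) = (P * P) $$ (i, i)" using P by simp
  also have "\<dots> = (\<Sum>k<n. (P $$ (i, k))\<^sup>2)"
    using P(1) ij sym by (simp add: scalar_prod_def lessThan_atLeast0 power2_eq_square)
  finally have eq: "P $$ (i, i) = (\<Sum>k<n. (P $$ (i, k))\<^sup>2)" .
  have le: "(P $$ (i, k))\<^sup>2 \<le> P $$ (i, i)" if "k < n" for k
    unfolding eq using that by (intro member_le_sum) auto
  have "P $$ (i, i) \<le> 1"
  proof (rule ccontr)
    assume "\<not> P $$ (i, i) \<le> 1"
    then have "P $$ (i, i) * 1 < P $$ (i, i) * P $$ (i, i)" by (intro mult_strict_left_mono) auto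
    with le[OF ij(1)] show False by (simp add: power2_eq_square)
  qed
  with le[OF ij(2)] have "(P $$ (i, j))\<^sup>2 \<le> 1" by linarith
  then show ?thesis by (simp add: abs_square_le_1)
qed

text \<open>Writing the inverse of \<open>W + \<delta> I\<close> by cofactors makes the approximants rational functions of the
  entries of \<open>W\<close>, hence measurable.\<close>

lemma range_projection_limit:
  assumes C: "C \<in> carrier_mat n q" and ij: "i < n" "j < n"
  defines "W \<equiv> C * C\<^sup>T"
  defines "T \<equiv> \<lambda>k. W + (1 / real (Suc k)) \<cdot>\<^sub>m 1\<^sub>m n"
  shows "(\<lambda>k. (W * adj_mat (T k)) $$ (i, j) / det (T k)) \<longlonglongrightarrow> range_projection C $$ (i, j)"
proof -
  define P where "P = range_projection C"
  have W: "W \<in> carrier_mat n n" "W\<^sup>T = W" using C by (auto simp: W_def transpose_mult_dim)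
  have P: "P \<in> carrier_mat n n" "P * W = W"
    using range_projection[OF C] by (auto simp: P_def W_def)
  obtain F where F: "F \<in> carrier_mat n n" "P = F * W"
    using range_projection(5)[OF C] by (auto simp: P_def W_def)
  obtain U d where U: "orthonormal_mat n U" and Wd: "W = conj_diag n U d"
    using symmetric_conj_diag[OF W] by metis
  note cU = conj_diag_carrier[OF U]
  \<comment> \<open>For a unit eigenvector \<open>u\<close> the eigenvalue of \<open>W\<close> is
    the squared norm of \<open>C\<^sup>T *\<^sub>v u\<close>. Hence adding a positive multiple of
    the identity makes \<open>W\<close> invertible.\<close>
  have d: "d l \<ge> 0" if l: "l < n" for l
  proof -
    define u where "u = col U l"
    have u: "u \<in> carrier_vec n" "scalar_prod u u = 1"
      using orthogonal_carrier[OF U] orthogonal_col_norm[OF U l] l by (auto simp: u_def)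
    have "d l = scalar_prod u (W *\<^sub>v u)"
      using conj_diag_mult_col[OF U l, of d] u by (simp add: Wd u_def[symmetric])
    also have "\<dots> = scalar_prod u (C *\<^sub>v (C\<^sup>T *\<^sub>v u))"
      using C u by (simp add: W_def mult_vec_assoc_dim del: assoc_mult_mat_vec)
    also have "\<dots> = scalar_prod (C\<^sup>T *\<^sub>v u) (C\<^sup>T *\<^sub>v u)"
      using transpose_vec_mult_scalar[OF C, of "C\<^sup>T *\<^sub>v u" u] C u
      by (simp add: mult_mat_vec_carrier[of _ q n])
    finally show ?thesis using scalar_prod_real_nonneg by simp
  qed
  \<comment> \<open>The spectral projection onto the range of \<open>W\<close>: its eigenvalues are
    1 where \<open>d l\<close> is nonzero and 0 elsewhere. It equals \<open>P\<close>, because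
    \<open>P * W = W\<close> yields \<open>P * E = E\<close>, while \<open>P = F * W\<close> and
    \<open>W * E = W\<close> yield \<open>P * E = P\<close>.\<close>
  define E where "E = conj_diag n U (\<lambda>l. d l * inverse (d l))"
  have "d l * inverse (d l) * d l = d l" "d l * (d l * inverse (d l)) = d l" for l
    by (cases "d l = 0"; simp)+
  note dd = this
  have EW: "E * W = W" "W * E = W"
    unfolding E_def Wd conj_diag_mult[OF U] dd by (rule refl)+
  have WH: "E = W * conj_diag n U (\<lambda>l. inverse (d l))"
    by (simp add: E_def Wd conj_diag_mult[OF U])
  have "P * E = P * W * conj_diag n U (\<lambda>l. inverse (d l))"
    unfolding WH using P(1) W(1) cU[of "\<lambda>l. inverse (d l)"] by (simp add: mult_assoc_dim del: assoc_mult_mat)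
  then have "P * E = E" using P(2) WH by simp
  moreover have "P * E = F * (W * E)"
    unfolding F(2) using F(1) W(1) cU[of "\<lambda>l. d l * inverse (d l)"]
    by (simp add: E_def[symmetric] mult_assoc_dim del: assoc_mult_mat)
  ultimately have PE: "P = E" using EW F by simp
  have entry: "(W * adj_mat (T k)) $$ (i, j) / det (T k)
      = (\<Sum>l<n. U $$ (i, l) * (d l * (1 / (d l + 1 / real (Suc k)))) * U $$ (j, l))" for k
  proof -
    let ?e = "1 / real (Suc k)"
    define X where "X = conj_diag n U (\<lambda>l. 1 / (d l + ?e))"
    have X: "X \<in> carrier_mat n n" by (simp add: X_def cU)
    have "?e \<cdot>\<^sub>m 1\<^sub>m n = conj_diag n U (\<lambda>_. ?e)"
    proof -
      have "conj_diag n U (\<lambda>_. ?e) = ?e \<cdot>\<^sub>m conj_diag n U (\<lambda>_. 1)"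
        using cU[of "\<lambda>_. ?e"] cU[of "\<lambda>_. 1"]
        by (intro eq_matI) (auto simp: conj_diag_index[OF U] sum_distrib_left mult_ac)
      then show ?thesis by (simp add: conj_diag_one[OF U])
    qed
    then have Td: "T k = conj_diag n U (\<lambda>l. d l + ?e)"
      by (simp add: T_def Wd conj_diag_add[OF U])
    have T: "T k \<in> carrier_mat n n" by (simp add: Td cU)
    have "d l + ?e \<noteq> 0" if "l < n" for l
      using d[OF that] by (simp add: add_nonneg_pos less_imp_neq[symmetric])
    then have "T k * X = conj_diag n U (\<lambda>_. 1)"
      unfolding Td X_def conj_diag_mult[OF U] by (intro conj_diag_cong[OF U]) simp
    then have TX: "T k * X = 1\<^sub>m n" by (simp add: conj_diag_one[OF U])
    have "det (T k) * det X = 1" using det_mult[OF T X] TX by simp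
    then have det: "det (T k) \<noteq> 0" by auto
    note adj = adj_mat[OF T]
    have "adj_mat (T k) = adj_mat (T k) * (T k * X)" using adj(1) by (simp add: TX)
    also have "\<dots> = (adj_mat (T k) * T k) * X"
      using adj(1) T X by (simp add: mult_assoc_dim del: assoc_mult_mat)
    also have "\<dots> = det (T k) \<cdot>\<^sub>m X"
      \<comment> \<open>\<open>X\<close> is the inverse of \<open>T k\<close>, so this is the
        cofactor formula for the inverse.\<close>
      using X by (simp add: adj(3) mult_smult_assoc_mat[of _ n n _ n])
    finally have "W * adj_mat (T k) = det (T k) \<cdot>\<^sub>m (W * X)"
      using W X by (simp add: mult_smult_distrib[of _ n n _ n])
    then have "(W * adj_mat (T k)) $$ (i, j) / det (T k) = (W * X) $$ (i, j)"
      using det ij W X by simp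
    also have "W * X = conj_diag n U (\<lambda>l. d l * (1 / (d l + ?e)))"
      by (simp only: Wd X_def conj_diag_mult[OF U])
    finally show ?thesis using ij by (simp only: conj_diag_index[OF U])
  qed
  \<comment> \<open>A zero eigenvalue gives the constant sequence 0, matching
    \<open>inverse 0 = 0\<close>; any other gives the limit 1.\<close>
  have lim: "(\<lambda>k. d l * (1 / (d l + 1 / real (Suc k)))) \<longlonglongrightarrow> d l * inverse (d l)" for l
  proof (cases "d l = 0")
    case False
    then have "(\<lambda>k. d l * (1 / (d l + 1 / real (Suc k)))) \<longlonglongrightarrow> d l * (1 / (d l + 0))"
      by (intro tendsto_intros LIMSEQ_Suc[OF lim_1_over_n]) auto
    then show ?thesis by (simp add: inverse_eq_divide)
  qed simp
  have "(\<lambda>k. (W * adj_mat (T k)) $$ (i, j) / det (T k))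
      \<longlonglongrightarrow> (\<Sum>l<n. U $$ (i, l) * (d l * inverse (d l)) * U $$ (j, l))"
    unfolding entry by (intro tendsto_intros lim)
  then show ?thesis
    using ij PE by (simp only: P_def[symmetric] E_def conj_diag_index[OF U])
qed

section \<open>Measurability of matrix-valued maps\<close>

definition measurable_mat :: "'w measure \<Rightarrow> nat \<Rightarrow> nat \<Rightarrow> ('w \<Rightarrow> real mat) \<Rightarrow> bool" where
  "measurable_mat P r c F \<longleftrightarrow> (\<forall>\<omega>\<in>space P. F \<omega> \<in> carrier_mat r c) \<and>
     (\<forall>i<r. \<forall>j<c. (\<lambda>\<omega>. F \<omega> $$ (i, j)) \<in> borel_measurable P)"

lemma measurable_mat_carrier: "measurable_mat P r c F \<Longrightarrow> \<omega> \<in> space P \<Longrightarrow> F \<omega> \<in> carrier_mat r c"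
  and measurable_mat_entry:
    "measurable_mat P r c F \<Longrightarrow> i < r \<Longrightarrow> j < c \<Longrightarrow> (\<lambda>\<omega>. F \<omega> $$ (i, j)) \<in> borel_measurable P"
  by (auto simp: measurable_mat_def)

lemma measurable_mat_const: "K \<in> carrier_mat r c \<Longrightarrow> measurable_mat P r c (\<lambda>_. K)"
  by (auto simp: measurable_mat_def)

lemma measurable_mat_mult:
  assumes "measurable_mat P r s F" "measurable_mat P s c H"
  shows "measurable_mat P r c (\<lambda>\<omega>. F \<omega> * H \<omega>)"
proof -
  have "(\<lambda>\<omega>. (F \<omega> * H \<omega>) $$ (i, j)) \<in> borel_measurable P" if ij: "i < r" "j < c" for i j
  proof -
    have "(\<lambda>\<omega>. \<Sum>k<s. F \<omega> $$ (i, k) * H \<omega> $$ (k, j)) \<in> borel_measurable P"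
      using assms ij
      by (intro borel_measurable_sum borel_measurable_times) (auto simp: measurable_mat_def)
    moreover have "(F \<omega> * H \<omega>) $$ (i, j) = (\<Sum>k<s. F \<omega> $$ (i, k) * H \<omega> $$ (k, j))"
      if "\<omega> \<in> space P" for \<omega>
      using measurable_mat_carrier[OF assms(1) that] measurable_mat_carrier[OF assms(2) that] ij
      by (simp add: scalar_prod_def lessThan_atLeast0)
    ultimately show ?thesis by (simp cong: measurable_cong)
  qed
  moreover have "F \<omega> * H \<omega> \<in> carrier_mat r c" if "\<omega> \<in> space P" for \<omega>
    using measurable_mat_carrier[OF assms(1) that] measurable_mat_carrier[OF assms(2) that] by simp
  ultimately show ?thesis by (simp add: measurable_mat_def)
qed

lemma measurable_mat_add:
  assumes "measurable_mat P r c F" "measurable_mat P r c H"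
  shows "measurable_mat P r c (\<lambda>\<omega>. F \<omega> + H \<omega>)"
proof -
  have "(\<lambda>\<omega>. (F \<omega> + H \<omega>) $$ (i, j)) \<in> borel_measurable P" if ij: "i < r" "j < c" for i j
  proof -
    have "(\<lambda>\<omega>. F \<omega> $$ (i, j) + H \<omega> $$ (i, j)) \<in> borel_measurable P"
      using assms ij by (intro borel_measurable_add) (auto simp: measurable_mat_def)
    moreover have "(F \<omega> + H \<omega>) $$ (i, j) = F \<omega> $$ (i, j) + H \<omega> $$ (i, j)" if "\<omega> \<in> space P" for \<omega>
      using measurable_mat_carrier[OF assms(1) that] measurable_mat_carrier[OF assms(2) that] ij
      by simp
    ultimately show ?thesis by (simp cong: measurable_cong)
  qed
  moreover have "F \<omega> + H \<omega> \<in> carrier_mat r c" if "\<omega> \<in> space P" for \<omega>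
    using measurable_mat_carrier[OF assms(1) that] measurable_mat_carrier[OF assms(2) that] by simp
  ultimately show ?thesis by (simp add: measurable_mat_def)
qed

text \<open>By the Leibniz formula the determinant is a polynomial in the entries.\<close>

lemma borel_measurable_det:
  assumes "measurable_mat P n n F"
  shows "(\<lambda>\<omega>. det (F \<omega>)) \<in> borel_measurable P"
proof -
  have "(\<lambda>\<omega>. \<Sum>p | p permutes {0..<n}. signof p * (\<Prod>i = 0..<n. F \<omega> $$ (i, p i)))
      \<in> borel_measurable P"
    using assms
    by (intro borel_measurable_sum borel_measurable_times borel_measurable_prod borel_measurable_const)
       (auto simp: measurable_mat_def dest: permutes_in_image)
  moreover have "det (F \<omega>) = (\<Sum>p | p permutes {0..<n}. signof p * (\<Prod>i = 0..<n. F \<omega> $$ (i, p i)))"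
    if "\<omega> \<in> space P" for \<omega>
    using measurable_mat_carrier[OF assms that] by (rule det_def')
  ultimately show ?thesis by (simp cong: measurable_cong)
qed

lemma measurable_mat_adj:
  assumes F: "measurable_mat P n n F"
  shows "measurable_mat P n n (\<lambda>\<omega>. adj_mat (F \<omega>))"
proof -
  have "(\<lambda>\<omega>. adj_mat (F \<omega>) $$ (i, j)) \<in> borel_measurable P" if ij: "i < n" "j < n" for i j
  proof -
    \<comment> \<open>Entry \<open>(i, j)\<close> of the adjugate is the cofactor at
      \<open>(j, i)\<close>, hence the swapped indices.\<close>
    have "measurable_mat P (n - 1) (n - 1) (\<lambda>\<omega>. mat_delete (F \<omega>) j i)"
      unfolding measurable_mat_def
    proof (intro conjI ballI allI impI)
      fix \<omega> assume "\<omega> \<in> space P"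
      then show "mat_delete (F \<omega>) j i \<in> carrier_mat (n - 1) (n - 1)"
        by (intro mat_delete_carrier measurable_mat_carrier[OF F])
    next
      fix a b assume ab: "a < n - 1" "b < n - 1"
      have "(\<lambda>\<omega>. F \<omega> $$ (if a < j then a else Suc a, if b < i then b else Suc b)) \<in> borel_measurable P"
        using ab by (intro measurable_mat_entry[OF F]) auto
      moreover have "mat_delete (F \<omega>) j i $$ (a, b)
          = F \<omega> $$ (if a < j then a else Suc a, if b < i then b else Suc b)" if "\<omega> \<in> space P" for \<omega>
        using measurable_mat_carrier[OF F that] ab by (auto simp: mat_delete_def)
      ultimately show "(\<lambda>\<omega>. mat_delete (F \<omega>) j i $$ (a, b)) \<in> borel_measurable P"
        by (simp cong: measurable_cong)
    qed
    then have "(\<lambda>\<omega>. (- 1) ^ (j + i) * det (mat_delete (F \<omega>) j i)) \<in> borel_measurable P"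
      by (intro borel_measurable_times borel_measurable_const borel_measurable_det)
    moreover have "adj_mat (F \<omega>) $$ (i, j) = (- 1) ^ (j + i) * det (mat_delete (F \<omega>) j i)"
      if "\<omega> \<in> space P" for \<omega>
      using measurable_mat_carrier[OF F that] ij by (auto simp: adj_mat_def cofactor_def)
    ultimately show ?thesis by (simp cong: measurable_cong)
  qed
  moreover have "adj_mat (F \<omega>) \<in> carrier_mat n n" if "\<omega> \<in> space P" for \<omega>
    using adj_mat(1)[OF measurable_mat_carrier[OF F that]] .
  ultimately show ?thesis by (simp add: measurable_mat_def)
qed

text \<open>The product has the fixed size \<open>m\<close> although the number of columns of
  \<open>S\<close> is random; this is where the randomness of that number is eliminated.\<close>

lemma random_mat_gram:
  assumes S: "random_mat P m S"
  shows "measurable_mat P m m (\<lambda>\<omega>. S \<omega> * (S \<omega>)\<^sup>T)"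
proof -
  have q[measurable]: "(\<lambda>\<omega>. dim_col (S \<omega>)) \<in> measurable P (count_space UNIV)"
    using S by (simp add: random_mat_def)
  \<comment> \<open>Extension by zero turns entries that are measurable only where they exist into
    functions measurable on the whole space.\<close>
  define s where "s = (\<lambda>i j \<omega>. if j < dim_col (S \<omega>) then S \<omega> $$ (i, j) else 0)"
  have s: "s i j \<in> borel_measurable P" if "i < m" for i j
  proof -
    have "{\<omega> \<in> space P. j < dim_col (S \<omega>)} \<in> sets P" by measurable
    moreover have "(\<lambda>\<omega>. S \<omega> $$ (i, j))
        \<in> borel_measurable (restrict_space P {\<omega> \<in> space P. j < dim_col (S \<omega>)})"
      using S that by (simp add: random_mat_def)
    ultimately have "(\<lambda>\<omega>. if \<omega> \<in> {\<omega> \<in> space P. j < dim_col (S \<omega>)} then S \<omega> $$ (i, j) else 0)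
        \<in> borel_measurable P"
      by (subst measurable_restrict_space_iff[symmetric]) auto
    then show ?thesis by (rule measurable_cong[THEN iffD1, rotated]) (auto simp: s_def)
  qed
  have "(\<lambda>\<omega>. (S \<omega> * (S \<omega>)\<^sup>T) $$ (i, j)) \<in> borel_measurable P" if ij: "i < m" "j < m" for i j
  proof -
    have "(\<lambda>\<omega>. \<Sum>k<q. s i k \<omega> * s j k \<omega>) \<in> borel_measurable P" for q
      using s ij by (intro borel_measurable_sum borel_measurable_times) auto
    \<comment> \<open>The upper limit of the sum takes countably many values, so measurability for
      each fixed \<open>q\<close> suffices.\<close>
    then have "(\<lambda>\<omega>. (\<lambda>q \<omega>. \<Sum>k<q. s i k \<omega> * s j k \<omega>) (dim_col (S \<omega>)) \<omega>) \<in> borel_measurable P"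
      by (rule measurable_compose_countable[OF _ q])
    moreover have "(S \<omega> * (S \<omega>)\<^sup>T) $$ (i, j) = (\<Sum>k<dim_col (S \<omega>). s i k \<omega> * s j k \<omega>)"
      if "\<omega> \<in> space P" for \<omega>
    proof -
      have "dim_row (S \<omega>) = m" using S that by (auto simp: random_mat_def)
      then show ?thesis using ij by (auto simp: s_def scalar_prod_def lessThan_atLeast0)
    qed
    ultimately show ?thesis by (simp cong: measurable_cong)
  qed
  moreover have "S \<omega> * (S \<omega>)\<^sup>T \<in> carrier_mat m m" if "\<omega> \<in> space P" for \<omega>
    using S that by (auto simp: random_mat_def)
  ultimately show ?thesis by (simp add: measurable_mat_def)
qed

lemma measurable_range_projection:
  assumes S: "random_mat P m S" and D: "D \<in> carrier_mat n m"
  shows "measurable_mat P n n (\<lambda>\<omega>. range_projection (D * S \<omega>))"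
proof -
  define W where "W = (\<lambda>\<omega>. (D * S \<omega>) * (D * S \<omega>)\<^sup>T)"
  have C: "D * S \<omega> \<in> carrier_mat n (dim_col (S \<omega>))" if "\<omega> \<in> space P" for \<omega>
    using S D that by (auto simp: random_mat_def intro!: carrier_matI)
  \<comment> \<open>Regrouped this way, \<open>W\<close> depends on \<open>S\<close> only through
    its Gram matrix of fixed size.\<close>
  have "measurable_mat P n n (\<lambda>\<omega>. D * (S \<omega> * (S \<omega>)\<^sup>T) * D\<^sup>T)"
    using D by (intro measurable_mat_mult[of _ _ m] measurable_mat_const random_mat_gram[OF S]) auto
  moreover have "W \<omega> = D * (S \<omega> * (S \<omega>)\<^sup>T) * D\<^sup>T" if "\<omega> \<in> space P" for \<omega>
    using S D that by (auto simp: W_def random_mat_def transpose_mult_dim mult_assoc_dim simp del: assoc_mult_mat)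
  ultimately have W: "measurable_mat P n n W"
    unfolding measurable_mat_def by (simp cong: measurable_cong)
  define T where "T = (\<lambda>k \<omega>. W \<omega> + (1 / real (Suc k)) \<cdot>\<^sub>m 1\<^sub>m n)"
  have T: "measurable_mat P n n (T k)" for k
    unfolding T_def by (intro measurable_mat_add W measurable_mat_const) auto
  have "(\<lambda>\<omega>. range_projection (D * S \<omega>) $$ (i, j)) \<in> borel_measurable P" if ij: "i < n" "j < n" for i j
  proof (rule borel_measurable_LIMSEQ_real)
    fix \<omega> assume "\<omega> \<in> space P"
    then show "(\<lambda>k. (W \<omega> * adj_mat (T k \<omega>)) $$ (i, j) / det (T k \<omega>))
        \<longlonglongrightarrow> range_projection (D * S \<omega>) $$ (i, j)"
      unfolding W_def T_def using range_projection_limit[OF C ij] by simp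
  next
    fix k
    show "(\<lambda>\<omega>. (W \<omega> * adj_mat (T k \<omega>)) $$ (i, j) / det (T k \<omega>)) \<in> borel_measurable P"
      using ij by (intro borel_measurable_divide borel_measurable_det[OF T]
          measurable_mat_entry[OF measurable_mat_mult[OF W measurable_mat_adj[OF T]]]) auto
  qed
  then show ?thesis using range_projection(1)[OF C] by (simp add: measurable_mat_def)
qed

section \<open>Entrywise expectation and linear operations\<close>

lemma expectation_mat_mult_vec:
  assumes F: "\<And>\<omega>. \<omega> \<in> space P \<Longrightarrow> F \<omega> \<in> carrier_mat r c"
    and int: "\<And>i j. i < r \<Longrightarrow> j < c \<Longrightarrow> integrable P (\<lambda>\<omega>. F \<omega> $$ (i, j))"
    and x: "x \<in> carrier_vec c" and i: "i < r"
  shows "integrable P (\<lambda>\<omega>. (F \<omega> *\<^sub>v x) $ i)"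
    and "(expectation_mat P r c F *\<^sub>v x) $ i = (\<integral>\<omega>. (F \<omega> *\<^sub>v x) $ i \<partial>P)"
proof -
  have eq: "(F \<omega> *\<^sub>v x) $ i = (\<Sum>j<c. F \<omega> $$ (i, j) * x $ j)" if "\<omega> \<in> space P" for \<omega>
    using F[OF that] x i by (simp add: scalar_prod_def lessThan_atLeast0)
  have "integrable P (\<lambda>\<omega>. \<Sum>j<c. F \<omega> $$ (i, j) * x $ j)"
    using int i by (intro Bochner_Integration.integrable_sum integrable_mult_left) auto
  then show "integrable P (\<lambda>\<omega>. (F \<omega> *\<^sub>v x) $ i)"
    using eq by (simp cong: Bochner_Integration.integrable_cong)
  have "(expectation_mat P r c F *\<^sub>v x) $ i = (\<Sum>j<c. (\<integral>\<omega>. F \<omega> $$ (i, j) \<partial>P) * x $ j)"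
    using x i by (simp add: expectation_mat_def scalar_prod_def lessThan_atLeast0)
  also have "\<dots> = (\<Sum>j<c. \<integral>\<omega>. F \<omega> $$ (i, j) * x $ j \<partial>P)"
    by simp
  also have "\<dots> = (\<integral>\<omega>. (\<Sum>j<c. F \<omega> $$ (i, j) * x $ j) \<partial>P)"
    using int i by (intro Bochner_Integration.integral_sum[symmetric] integrable_mult_left) auto
  also have "\<dots> = (\<integral>\<omega>. (F \<omega> *\<^sub>v x) $ i \<partial>P)"
    using eq by (simp cong: Bochner_Integration.integral_cong)
  finally show "(expectation_mat P r c F *\<^sub>v x) $ i = (\<integral>\<omega>. (F \<omega> *\<^sub>v x) $ i \<partial>P)" .
qed

lemma expectation_mat_scalar_prod:
  assumes F: "\<And>\<omega>. \<omega> \<in> space P \<Longrightarrow> F \<omega> \<in> carrier_mat r c"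
    and int: "\<And>i j. i < r \<Longrightarrow> j < c \<Longrightarrow> integrable P (\<lambda>\<omega>. F \<omega> $$ (i, j))"
    and x: "x \<in> carrier_vec c" and y: "y \<in> carrier_vec r"
  shows "scalar_prod y (expectation_mat P r c F *\<^sub>v x) = (\<integral>\<omega>. scalar_prod y (F \<omega> *\<^sub>v x) \<partial>P)"
proof -
  note E = expectation_mat_mult_vec[OF F int x]
  have "scalar_prod y (expectation_mat P r c F *\<^sub>v x)
      = (\<Sum>i<r. y $ i * (expectation_mat P r c F *\<^sub>v x) $ i)"
    by (simp add: scalar_prod_def lessThan_atLeast0 expectation_mat_def)
  also have "\<dots> = (\<Sum>i<r. \<integral>\<omega>. y $ i * (F \<omega> *\<^sub>v x) $ i \<partial>P)"
    by (intro sum.cong refl) (subst E(2), auto)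
  also have "\<dots> = (\<integral>\<omega>. (\<Sum>i<r. y $ i * (F \<omega> *\<^sub>v x) $ i) \<partial>P)"
    using E(1) by (intro Bochner_Integration.integral_sum[symmetric] integrable_mult_right) auto
  also have "\<dots> = (\<integral>\<omega>. scalar_prod y (F \<omega> *\<^sub>v x) \<partial>P)"
    using F by (intro Bochner_Integration.integral_cong refl)
      (auto simp: scalar_prod_def lessThan_atLeast0 intro!: sum.cong)
  finally show ?thesis .
qed

lemma integrable_mat_mult_const:
  fixes K :: "real mat"
  assumes F: "\<And>\<omega>. \<omega> \<in> space P \<Longrightarrow> F \<omega> \<in> carrier_mat r s"
    and int: "\<And>i j. i < r \<Longrightarrow> j < s \<Longrightarrow> integrable P (\<lambda>\<omega>. F \<omega> $$ (i, j))"
    and K: "K \<in> carrier_mat s c" and ij: "i < r" "j < c"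
  shows "integrable P (\<lambda>\<omega>. (F \<omega> * K) $$ (i, j))"
proof -
  have "integrable P (\<lambda>\<omega>. \<Sum>k<s. F \<omega> $$ (i, k) * K $$ (k, j))"
    using int ij by (intro Bochner_Integration.integrable_sum integrable_mult_left) auto
  moreover have "(F \<omega> * K) $$ (i, j) = (\<Sum>k<s. F \<omega> $$ (i, k) * K $$ (k, j))" if "\<omega> \<in> space P" for \<omega>
    using F[OF that] K ij by (simp add: scalar_prod_def lessThan_atLeast0)
  ultimately show ?thesis by (simp cong: Bochner_Integration.integrable_cong)
qed

lemma integrable_const_mat_mult:
  fixes K :: "real mat"
  assumes F: "\<And>\<omega>. \<omega> \<in> space P \<Longrightarrow> F \<omega> \<in> carrier_mat s c"
    and int: "\<And>i j. i < s \<Longrightarrow> j < c \<Longrightarrow> integrable P (\<lambda>\<omega>. F \<omega> $$ (i, j))"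
    and K: "K \<in> carrier_mat r s" and ij: "i < r" "j < c"
  shows "integrable P (\<lambda>\<omega>. (K * F \<omega>) $$ (i, j))"
proof -
  have "integrable P (\<lambda>\<omega>. \<Sum>k<s. K $$ (i, k) * F \<omega> $$ (k, j))"
    using int ij by (intro Bochner_Integration.integrable_sum integrable_mult_right) auto
  moreover have "(K * F \<omega>) $$ (i, j) = (\<Sum>k<s. K $$ (i, k) * F \<omega> $$ (k, j))" if "\<omega> \<in> space P" for \<omega>
    using F[OF that] K ij by (simp add: scalar_prod_def lessThan_atLeast0)
  ultimately show ?thesis by (simp cong: Bochner_Integration.integrable_cong)
qed

section \<open>Kernels, rank and nonempty spectrum\<close>

lemma trivial_kernel_full_rank:
  fixes A :: "'a :: field mat"
  assumes A: "A \<in> carrier_mat m n"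
    and ker: "\<And>x. x \<in> carrier_vec n \<Longrightarrow> A *\<^sub>v x = 0\<^sub>v m \<Longrightarrow> x = 0\<^sub>v n"
  shows "vec_space.rank m A = n"
proof -
  interpret vec_space "TYPE('a)" m .
  \<comment> \<open>Independence is stated for the set of columns, so repeated columns must be
    excluded first: equal columns \<open>i\<close> and \<open>j\<close> would put
    \<open>e_i - e_j\<close> into the kernel.\<close>
  have distinct: "distinct (cols A)"
    unfolding distinct_conv_nth
  proof (intro allI impI)
    fix i j assume ij: "i < length (cols A)" "j < length (cols A)" "i \<noteq> j"
    show "cols A ! i \<noteq> cols A ! j"
    proof
      assume *: "cols A ! i = cols A ! j"
      have ij': "i < n" "j < n" using ij A by auto
      define x where "x = (unit_vec n i - unit_vec n j :: 'a vec)"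
      have x: "x \<in> carrier_vec n" by (simp add: x_def)
      have "A *\<^sub>v unit_vec n k = col A k" if "k < n" for k
        using A that by (intro eq_vecI) auto
      then have "A *\<^sub>v x = col A i - col A j"
        unfolding x_def using ij' by (simp add: mult_minus_distrib_mat_vec[OF A])
      also have "\<dots> = 0\<^sub>v m" using * ij A by auto
      finally have "x = 0\<^sub>v n" using ker x by blast
      then have "x $ i = 0" using ij' by simp
      then show False using ij ij' by (simp add: x_def)
    qed
  qed
  show ?thesis
  proof (rule lin_indpt_full_rank[OF A distinct])
    show "lin_indpt (set (cols A))"
      using lin_depE[OF A _ distinct] ker by metis
  qed
qed

lemma invertible_mat_kernel:
  fixes E :: "'a :: comm_ring_1 mat"
  assumes E: "E \<in> carrier_mat n n" "invertible_mat E"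
    and x: "x \<in> carrier_vec n" "E *\<^sub>v x = 0\<^sub>v n"
  shows "x = 0\<^sub>v n"
proof -
  \<comment> \<open>Invertibility does not state the size of \<open>X\<close>; it is recovered by
    comparing dimensions in the two identities.\<close>
  obtain X where X: "E * X = 1\<^sub>m n" "X * E = 1\<^sub>m (dim_row X)"
    using E by (auto simp: invertible_mat_def inverts_mat_def)
  have "dim_col (X * E) = dim_row X" using X(2) by simp
  then have Xr: "dim_row X = n" using E by simp
  have "dim_col (E * X) = n" using X(1) by simp
  then have Xc: "X \<in> carrier_mat n n" using Xr by (auto intro!: carrier_matI)
  have "x = X * E *\<^sub>v x" using X x Xr by simp
  also have "\<dots> = X *\<^sub>v (E *\<^sub>v x)" using Xc E x by (intro assoc_mult_mat_vec) auto
  also have "\<dots> = 0\<^sub>v n" using Xc x by (auto intro!: eq_vecI)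
  finally show ?thesis .
qed

text \<open>Ensures that the minimum in \<open>lambda_min\<close> is taken over a nonempty
  set.\<close>

lemma spectrum_symmetric_nonempty:
  fixes M :: "real mat"
  assumes "M \<in> carrier_mat n n" "M\<^sup>T = M" "n > 0"
  shows "spectrum M \<noteq> {}"
proof -
  obtain v k where "v \<in> carrier_vec n" "v \<noteq> 0\<^sub>v n" "M *\<^sub>v v = k \<cdot>\<^sub>v v"
    using symmetric_real_eigenvector[OF assms] .
  then have "eigenvector M v k" using assms(1) by (simp add: eigenvector_def)
  then show ?thesis by (auto simp: spectrum_def eigenvalue_def)
qed

section \<open>Projection form of the sketch, and the theorem itself\<close>

text \<open>Because \<open>inv_mat B = L * L\<close>, the matrix under the pseudoinverse is the Gram
  matrix of \<open>L * A\<^sup>T * S\<close>. The outer factors \<open>R\<close> then cancel the two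
  remaining copies of \<open>L\<close>.\<close>

lemma sketch_Z_eq_range_projection:
  fixes A B S :: "real mat"
  defines "R \<equiv> sqrt_mat B" and "L \<equiv> inv_sqrt_mat B"
  assumes A: "A \<in> carrier_mat m n" and B: "spd_mat n B" and S: "dim_row S = m"
  shows "sketch_Z A B S = R * range_projection (L * A\<^sup>T * S) * R"
proof -
  have spdR: "spd_mat n R" and RR: "R * R = B" using spd_sqrt_mat[OF B] by (auto simp: R_def)
  have R: "R \<in> carrier_mat n n" "R\<^sup>T = R" using spdR by (auto simp: spd_mat_def)
  have L: "L \<in> carrier_mat n n" "R * L = 1\<^sub>m n" "L * R = 1\<^sub>m n" "L\<^sup>T = L"
    using spd_inv_mat[OF spdR] by (auto simp: L_def R_def inv_sqrt_mat_def)
  have "inv_mat B = L * L"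
  proof (rule inv_mat_eqI)
    have "B * (L * L) = R * (R * L) * L"
      using R(1) L(1) by (simp add: RR[symmetric] mult_assoc_dim del: assoc_mult_mat)
    then show "B * (L * L) = 1\<^sub>m n" using R L by simp
    have "(L * L) * B = L * (L * R) * R"
      using R(1) L(1) by (simp add: RR[symmetric] mult_assoc_dim del: assoc_mult_mat)
    then show "(L * L) * B = 1\<^sub>m n" using R L by simp
  qed (use B L in \<open>auto simp: spd_mat_def\<close>)
  define C where "C = L * A\<^sup>T * S"
  have CT: "C\<^sup>T = S\<^sup>T * (A * L)"
    using A S L by (simp add: C_def transpose_mult_dim mult_assoc_dim del: assoc_mult_mat)
  have gram: "S\<^sup>T * A * inv_mat B * A\<^sup>T * S = C\<^sup>T * C"
    unfolding CT unfolding C_def \<open>inv_mat B = L * L\<close>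
    using A S L(1) by (simp add: mult_assoc_dim del: assoc_mult_mat)
  define G where "G = mp_inverse (C\<^sup>T * C)"
  have "C\<^sup>T * C \<in> carrier_mat (dim_col S) (dim_col S)" "(C\<^sup>T * C)\<^sup>T = C\<^sup>T * C"
    by (auto simp: C_def transpose_mult_dim intro!: carrier_matI)
  from symmetric_mp_inverse(1)[OF this]
  have G: "dim_row G = dim_col S" "dim_col G = dim_col S"
    by (auto simp: is_mp_inverse_def G_def C_def)
  have "R * range_projection C * R = (R * L) * A\<^sup>T * S * G * (S\<^sup>T * A * (L * R))"
    unfolding range_projection_def G_def[symmetric] unfolding CT unfolding C_def
    using A S L(1) R(1) G by (simp add: mult_assoc_dim del: assoc_mult_mat)
  also have "\<dots> = A\<^sup>T * S * G * S\<^sup>T * A"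
    using A S G unfolding L(2,3) by (simp add: mult_assoc_dim del: assoc_mult_mat)
  finally show ?thesis by (simp add: sketch_Z_def gram G_def C_def)
qed

theorem lemma4p3:
  fixes A B :: "real mat" and b :: "real vec" and m n :: nat
    and P :: "'w measure" and S :: "'w \<Rightarrow> real mat"
  assumes "0 < n"
    and "A \<in> carrier_mat m n"
    and "b \<in> carrier_vec m"
    and "\<exists>x \<in> carrier_vec n. A *\<^sub>v x = b"
    and "spd_mat n B"
    and "prob_space P"
    and "random_mat P m S"
    and "invertible_mat (expected_Z P A B S)"
  shows "rho P A B S < 1 \<and> vec_space.rank m A = n \<and>
         (\<exists>!x. x \<in> carrier_vec n \<and> A *\<^sub>v x = b)"
proof -
  note A = assms(2) and B = assms(5) and S = assms(7)
  interpret prob_space P by fact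
  define R where "R = sqrt_mat B"
  define L where "L = inv_sqrt_mat B"
  define Q where "Q = (\<lambda>\<omega>. range_projection (L * A\<^sup>T * S \<omega>))"
  define Z where "Z = (\<lambda>\<omega>. sketch_Z A B (S \<omega>))"
  define E where "E = expected_Z P A B S"
  have spdR: "spd_mat n R" using spd_sqrt_mat[OF B] by (simp add: R_def)
  have R: "R \<in> carrier_mat n n" "R\<^sup>T = R" using spdR by (auto simp: spd_mat_def)
  have L: "L \<in> carrier_mat n n" "R * L = 1\<^sub>m n" "L\<^sup>T = L"
    using spd_inv_mat[OF spdR] by (auto simp: L_def R_def inv_sqrt_mat_def)
  have dimS: "dim_row (S \<omega>) = m" if "\<omega> \<in> space P" for \<omega>
    using S that by (simp add: random_mat_def)
  have LA: "L * A\<^sup>T \<in> carrier_mat n m" using L A by simp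
  have Qm: "measurable_mat P n n Q"
    unfolding Q_def by (rule measurable_range_projection[OF S LA])
  have "L * A\<^sup>T * S \<omega> \<in> carrier_mat n (dim_col (S \<omega>))" if "\<omega> \<in> space P" for \<omega>
    using LA dimS[OF that] by (auto intro!: carrier_matI)
  from range_projection(1-3)[OF this]
  have Q: "Q \<omega> \<in> carrier_mat n n" "(Q \<omega>)\<^sup>T = Q \<omega>" "Q \<omega> * Q \<omega> = Q \<omega>" if "\<omega> \<in> space P" for \<omega>
    using that by (simp_all add: Q_def)
  have ZR: "Z \<omega> = R * Q \<omega> * R" if "\<omega> \<in> space P" for \<omega>
    using sketch_Z_eq_range_projection[OF A B dimS[OF that]] by (simp add: Z_def R_def L_def Q_def)
  have Z: "Z \<omega> \<in> carrier_mat n n" "(Z \<omega>)\<^sup>T = Z \<omega>" if "\<omega> \<in> space P" for \<omega>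
    using ZR[OF that] Q[OF that] R
    by (auto simp: transpose_mult_dim mult_assoc_dim simp del: assoc_mult_mat)
  \<comment> \<open>Bounded measurable functions are integrable on a probability space; this passes
    to \<open>Z\<close> by multiplication with the constant \<open>R\<close>.\<close>
  have "integrable P (\<lambda>\<omega>. Q \<omega> $$ (i, j))" if ij: "i < n" "j < n" for i j
    using symmetric_idempotent_entry_bound[OF Q ij]
    by (intro integrable_const_bound[where B = 1] AE_I2 measurable_mat_entry[OF Qm ij]) auto
  then have "integrable P (\<lambda>\<omega>. (R * Q \<omega> * R) $$ (i, j))" if ij: "i < n" "j < n" for i j
    using ij Q(1) R(1)
    by (intro integrable_mat_mult_const[of P _ n n] integrable_const_mat_mult[of P _ n n]) auto
  then have intZ: "integrable P (\<lambda>\<omega>. Z \<omega> $$ (i, j))" if "i < n" "j < n" for i j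
    using that ZR by (simp cong: Bochner_Integration.integrable_cong)
  have E_eq: "E = expectation_mat P n n Z" using A by (simp add: E_def expected_Z_def Z_def)
  have E: "E \<in> carrier_mat n n" by (simp add: E_eq expectation_mat_def)
  have Z_sym: "Z \<omega> $$ (i, j) = Z \<omega> $$ (j, i)" if "\<omega> \<in> space P" "i < n" "j < n" for \<omega> i j
    using Z[OF that(1)] that by (metis carrier_matD index_transpose_mat(1))
  have ET: "E\<^sup>T = E"
    by (rule eq_matI)
      (auto simp: E_eq expectation_mat_def intro!: Bochner_Integration.integral_cong Z_sym)
  have Einj: "x = 0\<^sub>v n" if "x \<in> carrier_vec n" "E *\<^sub>v x = 0\<^sub>v n" for x
    using invertible_mat_kernel[OF E _ that] assms(8) by (simp add: E_def)
  have Epsd: "scalar_prod x (E *\<^sub>v x) \<ge> 0" if x: "x \<in> carrier_vec n" for x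
  proof -
    \<comment> \<open>The form equals the squared norm of
      \<open>Q \<omega> *\<^sub>v (R *\<^sub>v x)\<close>, by symmetry and idempotence of
      \<open>Q \<omega>\<close>.\<close>
    have "scalar_prod x (Z \<omega> *\<^sub>v x) \<ge> 0" if \<omega>: "\<omega> \<in> space P" for \<omega>
    proof -
      define y where "y = R *\<^sub>v x"
      have y: "y \<in> carrier_vec n" "Q \<omega> *\<^sub>v y \<in> carrier_vec n"
        using R x Q[OF \<omega>] by (auto simp: y_def intro: mult_mat_vec_carrier)
      have "Z \<omega> *\<^sub>v x = R *\<^sub>v (Q \<omega> *\<^sub>v y)"
        using R x Q[OF \<omega>] by (simp add: ZR[OF \<omega>] y_def mult_vec_assoc_dim del: assoc_mult_mat_vec)
      then have "scalar_prod x (Z \<omega> *\<^sub>v x) = scalar_prod y (Q \<omega> *\<^sub>v y)"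
        using symmetric_scalar_prod[OF R x y(2)] by (simp add: y_def)
      also have "\<dots> = scalar_prod y (Q \<omega> *\<^sub>v (Q \<omega> *\<^sub>v y))"
        using Q[OF \<omega>] y by (metis assoc_mult_mat_vec)
      also have "\<dots> = scalar_prod (Q \<omega> *\<^sub>v y) (Q \<omega> *\<^sub>v y)"
        by (rule symmetric_scalar_prod[OF Q(1)[OF \<omega>] Q(2)[OF \<omega>] y, symmetric])
      finally show ?thesis using scalar_prod_real_nonneg by simp
    qed
    then have "(\<integral>\<omega>. scalar_prod x (Z \<omega> *\<^sub>v x) \<partial>P) \<ge> 0"
      by (intro Bochner_Integration.integral_nonneg_AE AE_I2) auto
    moreover have "scalar_prod x (E *\<^sub>v x) = (\<integral>\<omega>. scalar_prod x (Z \<omega> *\<^sub>v x) \<partial>P)"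
      unfolding E_eq by (rule expectation_mat_scalar_prod[OF _ _ x x]) (simp_all add: Z(1) intZ)
    ultimately show ?thesis by simp
  qed
  have kerA: "x = 0\<^sub>v n" if x: "x \<in> carrier_vec n" "A *\<^sub>v x = 0\<^sub>v m" for x
  proof -
    \<comment> \<open>The rightmost factor of \<open>Z\<close> is \<open>A\<close>, so a kernel
      vector of \<open>A\<close> is killed for every outcome and hence by \<open>E\<close>, which is
      injective.\<close>
    have "Z \<omega> *\<^sub>v x = 0\<^sub>v n" if \<omega>: "\<omega> \<in> space P" for \<omega>
    proof -
      let ?Y = "A\<^sup>T * S \<omega> * mp_inverse ((S \<omega>)\<^sup>T * A * inv_mat B * A\<^sup>T * S \<omega>) * (S \<omega>)\<^sup>T"
      have dY: "dim_row ?Y = n" "dim_col ?Y = m" using A dimS[OF \<omega>] by auto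
      have "Z \<omega> *\<^sub>v x = ?Y *\<^sub>v (A *\<^sub>v x)"
        unfolding Z_def sketch_Z_def using A x dY(2) by (intro mult_vec_assoc_dim) auto
      also have "\<dots> = 0\<^sub>v n"
      proof -
        have "Y *\<^sub>v 0\<^sub>v m = 0\<^sub>v n" if "dim_row Y = n" "dim_col Y = m" for Y :: "real mat"
          using that by (intro eq_vecI) (auto simp: scalar_prod_def)
        from this[OF dY] show ?thesis by (simp only: x(2))
      qed
      finally show ?thesis .
    qed
    then have "(\<integral>\<omega>. (Z \<omega> *\<^sub>v x) $ i \<partial>P) = (\<integral>\<omega>. 0 \<partial>P)" if "i < n" for i
      using that by (intro Bochner_Integration.integral_cong) auto
    moreover have "(E *\<^sub>v x) $ i = (\<integral>\<omega>. (Z \<omega> *\<^sub>v x) $ i \<partial>P)" if "i < n" for i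
      unfolding E_eq by (rule expectation_mat_mult_vec(2)[OF _ _ x(1) that]) (simp_all add: Z(1) intZ)
    ultimately have "(E *\<^sub>v x) $ i = 0" if "i < n" for i using that by simp
    then have "E *\<^sub>v x = 0\<^sub>v n" using E by (intro eq_vecI) auto
    then show ?thesis using Einj x by blast
  qed
  have "x = y" if "x \<in> carrier_vec n" "y \<in> carrier_vec n" "A *\<^sub>v x = b" "A *\<^sub>v y = b" for x y
  proof -
    have "A *\<^sub>v (x - y) = 0\<^sub>v m"
      using that A assms(3) by (simp add: mult_minus_distrib_mat_vec[OF A])
    then have "x - y = 0\<^sub>v n" using kerA that by simp
    then have "x $ i - y $ i = 0" if "i < n" for i
      using \<open>x \<in> carrier_vec n\<close> \<open>y \<in> carrier_vec n\<close> that
      by (metis carrier_vecD index_minus_vec(1) index_zero_vec(1))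
    then show "x = y" using that by (intro eq_vecI) auto
  qed
  then have unique: "\<exists>!x. x \<in> carrier_vec n \<and> A *\<^sub>v x = b" using assms(4) by blast
  define N where "N = L * E * L"
  have N: "N \<in> carrier_mat n n" "N\<^sup>T = N"
    using L E ET by (auto simp: N_def transpose_mult_dim mult_assoc_dim simp del: assoc_mult_mat)
  have pos: "k > 0" if k: "k \<in> spectrum N" for k
  proof -
    obtain v where v: "v \<in> carrier_vec n" "v \<noteq> 0\<^sub>v n" "N *\<^sub>v v = k \<cdot>\<^sub>v v"
      using k N(1) by (auto simp: spectrum_def eigenvalue_def eigenvector_def)
    define w where "w = L *\<^sub>v v"
    have w: "w \<in> carrier_vec n" "E *\<^sub>v w \<in> carrier_vec n"
      using L v E by (auto simp: w_def intro: mult_mat_vec_carrier)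
    have Rw: "R *\<^sub>v w = v" using assoc_mult_mat_vec[OF R(1) L(1) v(1)] L(2) v(1) by (simp add: w_def)
    have Nv: "N *\<^sub>v v = L *\<^sub>v (E *\<^sub>v w)"
      using L E v by (simp add: N_def w_def mult_vec_assoc_dim del: assoc_mult_mat_vec)
    \<comment> \<open>The substitution \<open>w = L *\<^sub>v v\<close> turns the form of
      \<open>N\<close> at \<open>v\<close> into that of \<open>E\<close> at \<open>w\<close>, so
      \<open>k\<close> is nonnegative. If \<open>k\<close> were 0, applying \<open>R\<close> would
      give \<open>E *\<^sub>v w = 0\<^sub>v n\<close>, then \<open>w = 0\<^sub>v n\<close> and
      \<open>v = R *\<^sub>v w = 0\<^sub>v n\<close>.\<close>
    have "k * scalar_prod v v = scalar_prod v (N *\<^sub>v v)" using v by simp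
    also have "\<dots> = scalar_prod w (E *\<^sub>v w)"
      unfolding Nv using symmetric_scalar_prod[OF L(1,3) v(1) w(2)] by (simp add: w_def)
    finally have "k * scalar_prod v v \<ge> 0" using Epsd[OF w(1)] by simp
    then have "k \<ge> 0" using scalar_prod_real_pos[OF v(1,2)] by (simp add: zero_le_mult_iff)
    moreover have "k \<noteq> 0"
    proof
      assume "k = 0"
      then have "L *\<^sub>v (E *\<^sub>v w) = 0\<^sub>v n" using v Nv by auto
      then have "R *\<^sub>v (L *\<^sub>v (E *\<^sub>v w)) = 0\<^sub>v n" using R by (auto intro!: eq_vecI)
      then have "E *\<^sub>v w = 0\<^sub>v n"
        using assoc_mult_mat_vec[OF R(1) L(1) w(2)] L(2) w(2) by simp
      then have "w = 0\<^sub>v n" using Einj w(1) by blast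
      then have "v = 0\<^sub>v n" using Rw R by (auto intro!: eq_vecI)
      with v(2) show False by simp
    qed
    ultimately show ?thesis by simp
  qed
  \<comment> \<open>The spectrum is finite and, as \<open>n\<close> is positive, nonempty, so
    \<open>lambda_min\<close> is an actual eigenvalue and hence positive.\<close>
  have "Min (spectrum N) \<in> spectrum N"
    using card_finite_spectrum(1)[OF N(1)] spectrum_symmetric_nonempty[OF N assms(1)] by (rule Min_in)
  from pos[OF this] have "rho P A B S < 1"
    by (simp add: rho_def lambda_min_def N_def L_def E_def)
  with unique trivial_kernel_full_rank[OF A kerA] show ?thesis by blast
qed

end
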